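(* Let $\Lambda$ be an integral domain endowed with a ring involution. The core of $\mathbf{L}_\Lambda$ consists of Hermitian $\Lambda$-modules, as objects, and isomorphism classes of invertible Lagrangian cospans, as morphisms. Furthermore, the map assigning to such a cospan $H\xrightarrow{i}T\xleftarrow{i'}H'$ the $\Lambda$-isomorphism $i'^{-1}i\colon H\to H'$ gives rise to an equivalence of categories $\mathit{core}(\mathbf{L}_\Lambda)\xrightarrow{\simeq}\mathbf{U}_\Lambda$, and the square formed by this equivalence, the inclusion $\mathit{core}(\mathbf{L}_\Lambda)\to\mathbf{L}_\Lambda$, the functor $F\colon\mathbf{L}_\Lambda\to\mathbf{Lagr}_\Lambda$ and the graph functor $\Gamma\colon\mathbf{U}_\Lambda\to\mathbf{Lagr}_\Lambda$ commutes; that is, the composition $\mathit{core}(\mathbf{L}_\Lambda)\to\mathbf{L}_\Lambda\xrightarrow{F}\mathbf{Lagr}_\Lambda$ equals the composition $\mathit{core}(\mathbf{L}_\Lambda)\xrightarrow{\simeq}\mathbf{U}_\Lambda\xrightarrow{\Gamma}\mathbf{Lagr}_\Lambda$.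
   Context: A skew-Hermitian form on a $\Lambda$-module $H$ is a map $\omega\colon H\times H\to\Lambda$ such that (i) $\omega(\lambda x+\lambda'y,z)=\lambda\omega(x,z)+\lambda'\omega(y,z)$; (ii) $\omega(x,y)=-\overline{\omega(y,x)}$; (iii) if $\omega(x,y)=0$ for all $y\in H$, then $x=0$. A Hermitian $\Lambda$-module is a finitely generated $\Lambda$-module $H$ endowed with a skew-Hermitian form $\omega$; $-H$ denotes the same module with the form $-\omega$. For a submodule $A\subset H$, $\mathrm{Ann}(A)=\{x\in H\mid\omega(v,x)=0\ \forall v\in A\}$, and $A$ is Lagrangian if $A=\mathrm{Ann}(A)$. Also set $\overline{A}=\{x\in H\mid\lambda x\in A\text{ for some non-zero }\lambda\in\Lambda\}$. A $\Lambda$-linear map between Hermitian $\Lambda$-modules is unitary if it preserves the forms. $\mathbf{U}_\Lambda$ is the category of Hermitian $\Lambda$-modules and unitary $\Lambda$-isomorphisms. The category $\mathbf{Lagr}_\Lambda$ has Hermitian $\Lambda$-modules as objects; a morphism from $H$ to $H'$ is a Lagrangian submodule of $(-H)\oplus H'$; the composition of $N_1$ from $H$ to $H'$ and $N_2$ from $H'$ to $H''$ is $\overline{N_2N_1}$, where $N_2N_1=\{x\oplus z\mid x\oplus y\in N_1,\ y\oplus z\in N_2\text{ for some }y\in H'\}$; identities are the diagonals. The graph functor $\Gamma\colon\mathbf{U}_\Lambda\to\mathbf{Lagr}_\Lambda$ is the identity on objects and sends $f\colon H\to H'$ to $\Gamma_f=\{x\oplus f(x)\mid x\in H\}$ (this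 is known to be a faithful functor). A cospan from $H$ to $H'$ is a diagram of $\Lambda$-modules $H\xrightarrow{i}T\xleftarrow{i'}H'$; two cospans $(T_1,i_1,i_1')$, $(T_2,i_2,i_2')$ from $H$ to $H'$ are isomorphic if there is an isomorphism $f\colon T_1\to T_2$ with $fi_1=i_2$, $fi_1'=i_2'$. Set $N_T=\{(x,y)\in H\oplus H'\mid i'(y)=i(x)\}$. The cospan is Lagrangian if $H,H'$ are Hermitian and $\overline{N_T}$ is a Lagrangian submodule of $(-H)\oplus H'$; it is invertible if $i$ and $i'$ are $\Lambda$-isomorphisms. $\mathbf{L}_\Lambda$ is the category with Hermitian $\Lambda$-modules as objects and isomorphism classes of Lagrangian cospans as morphisms, where the composition of $H\xrightarrow{i_1}T_1\xleftarrow{i_1'}H'$ and $H'\xrightarrow{i_2'}T_2\xleftarrow{i_2''}H''$ is $H\xrightarrow{j_1i_1}P\xleftarrow{j_2i_2''}H''$ with $T_1\xrightarrow{j_1}P\xleftarrow{j_2}T_2$ a pushout of $T_1\xleftarrow{i_1'}H'\xrightarrow{i_2'}T_2$, and the identity of $H$ is $H\xrightarrow{\mathrm{id}}H\xleftarrow{\mathrm{id}}H$. The functor $F\colon\mathbf{L}_\Lambda\to\mathbf{Lagr}_\Lambda$ is the identity on objects and sends $T$ to $\overline{N_T}$. The core of a category is its maximal sub-groupoid: all objects, with morphisms all isomorphisms of the category. *)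

theory Defs
  imports "HOL-Algebra.Module" "HOL-Library.FuncSet"
begin

section \<open>Categories, functors, equivalences\<close>

text \<open>Arrows are tagged by their source and target: \<open>Comp C x y z g f\<close> is the composite of
  \<open>f \<in> Hom C x y\<close> followed by \<open>g \<in> Hom C y z\<close>.  Distinct hom-sets need not be disjoint.\<close>

record ('o, 'm) cat =
  Obj :: "'o set"
  Hom :: "'o \<Rightarrow> 'o \<Rightarrow> 'm set"
  Comp :: "'o \<Rightarrow> 'o \<Rightarrow> 'o \<Rightarrow> 'm \<Rightarrow> 'm \<Rightarrow> 'm"
  Ident :: "'o \<Rightarrow> 'm"

locale category =
  fixes C :: "('o, 'm) cat"
  assumes Ident_in_Hom: "x \<in> Obj C \<Longrightarrow> Ident C x \<in> Hom C x x"
    and Comp_in_Hom: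
      "\<lbrakk>x \<in> Obj C; y \<in> Obj C; z \<in> Obj C; f \<in> Hom C x y; g \<in> Hom C y z\<rbrakk>
        \<Longrightarrow> Comp C x y z g f \<in> Hom C x z"
    and Comp_Ident_right:
      "\<lbrakk>x \<in> Obj C; y \<in> Obj C; f \<in> Hom C x y\<rbrakk> \<Longrightarrow> Comp C x x y f (Ident C x) = f"
    and Comp_Ident_left:
      "\<lbrakk>x \<in> Obj C; y \<in> Obj C; f \<in> Hom C x y\<rbrakk> \<Longrightarrow> Comp C x y y (Ident C y) f = f"
    and Comp_assoc:
      "\<lbrakk>w \<in> Obj C; x \<in> Obj C; y \<in> Obj C; z \<in> Obj C;
        f \<in> Hom C w x; g \<in> Hom C x y; h \<in> Hom C y z\<rbrakk>
        \<Longrightarrow> Comp C w y z h (Comp C w x y g f) = Comp C w x z (Comp C x y z h g) f"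

definition cat_iso :: "('o, 'm) cat \<Rightarrow> 'o \<Rightarrow> 'o \<Rightarrow> 'm \<Rightarrow> bool" where
  "cat_iso C x y f \<longleftrightarrow> f \<in> Hom C x y \<and>
     (\<exists>g \<in> Hom C y x. Comp C x y x g f = Ident C x \<and> Comp C y x y f g = Ident C y)"

definition core :: "('o, 'm) cat \<Rightarrow> ('o, 'm) cat" where
  "core C = C\<lparr>Hom := \<lambda>x y. {f. cat_iso C x y f}\<rparr>"

record ('o, 'm, 'p, 'n) cat_map =
  on_obj :: "'o \<Rightarrow> 'p"
  on_arr :: "'o \<Rightarrow> 'o \<Rightarrow> 'm \<Rightarrow> 'n"

definition is_functor ::
  "('o, 'm) cat \<Rightarrow> ('p, 'n) cat \<Rightarrow> ('o, 'm, 'p, 'n) cat_map \<Rightarrow> bool" where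
  "is_functor C D F \<longleftrightarrow> category C \<and> category D \<and>
     (\<forall>x \<in> Obj C. on_obj F x \<in> Obj D) \<and>
     (\<forall>x \<in> Obj C. \<forall>y \<in> Obj C. \<forall>f \<in> Hom C x y.
        on_arr F x y f \<in> Hom D (on_obj F x) (on_obj F y)) \<and>
     (\<forall>x \<in> Obj C. on_arr F x x (Ident C x) = Ident D (on_obj F x)) \<and>
     (\<forall>x \<in> Obj C. \<forall>y \<in> Obj C. \<forall>z \<in> Obj C. \<forall>f \<in> Hom C x y. \<forall>g \<in> Hom C y z.
        on_arr F x z (Comp C x y z g f) =
          Comp D (on_obj F x) (on_obj F y) (on_obj F z) (on_arr F y z g) (on_arr F x y f))"

definition id_functor :: "('o, 'm, 'o, 'm) cat_map" where
  "id_functor = \<lparr>on_obj = (\<lambda>x. x), on_arr = (\<lambda>x y f. f)\<rparr>"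

text \<open>The objects and arrows of \<open>core C\<close> are objects and arrows of \<open>C\<close>, so the inclusion does
  nothing to them.\<close>

definition core_inclusion :: "('o, 'm, 'o, 'm) cat_map" where
  "core_inclusion = id_functor"

definition comp_functor ::
  "('p, 'n, 'q, 'k) cat_map \<Rightarrow> ('o, 'm, 'p, 'n) cat_map \<Rightarrow> ('o, 'm, 'q, 'k) cat_map" where
  "comp_functor G F =
     \<lparr>on_obj = (\<lambda>x. on_obj G (on_obj F x)),
      on_arr = (\<lambda>x y f. on_arr G (on_obj F x) (on_obj F y) (on_arr F x y f))\<rparr>"

text \<open>Equality of two functors from \<open>C\<close> to \<open>D\<close> means equality on objects and arrows of \<open>C\<close>
  (values elsewhere are irrelevant); the common values are required to lie in \<open>D\<close>.\<close>

definition functors_equal ::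
  "('o, 'm) cat \<Rightarrow> ('p, 'n) cat \<Rightarrow> ('o, 'm, 'p, 'n) cat_map \<Rightarrow> ('o, 'm, 'p, 'n) cat_map \<Rightarrow> bool"
  where
  "functors_equal C D F G \<longleftrightarrow>
     (\<forall>x \<in> Obj C. on_obj F x \<in> Obj D \<and> on_obj F x = on_obj G x) \<and>
     (\<forall>x \<in> Obj C. \<forall>y \<in> Obj C. \<forall>f \<in> Hom C x y.
        on_arr F x y f \<in> Hom D (on_obj F x) (on_obj F y) \<and> on_arr F x y f = on_arr G x y f)"

definition naturally_isomorphic ::
  "('o, 'm) cat \<Rightarrow> ('p, 'n) cat \<Rightarrow> ('o, 'm, 'p, 'n) cat_map \<Rightarrow> ('o, 'm, 'p, 'n) cat_map \<Rightarrow> bool"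
  where
  "naturally_isomorphic C D F G \<longleftrightarrow>
     (\<exists>\<eta>. (\<forall>x \<in> Obj C. cat_iso D (on_obj F x) (on_obj G x) (\<eta> x)) \<and>
          (\<forall>x \<in> Obj C. \<forall>y \<in> Obj C. \<forall>f \<in> Hom C x y.
             Comp D (on_obj F x) (on_obj F y) (on_obj G y) (\<eta> y) (on_arr F x y f) =
             Comp D (on_obj F x) (on_obj G x) (on_obj G y) (on_arr G x y f) (\<eta> x)))"

definition is_equivalence ::
  "('o, 'm) cat \<Rightarrow> ('p, 'n) cat \<Rightarrow> ('o, 'm, 'p, 'n) cat_map \<Rightarrow> bool" where
  "is_equivalence C D F \<longleftrightarrow> is_functor C D F \<and>
     (\<exists>G. is_functor D C G \<and>
          naturally_isomorphic C C (comp_functor G F) id_functor \<and>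
          naturally_isomorphic D D (comp_functor F G) id_functor)"


section \<open>Linear maps and pushouts\<close>

text \<open>Modules are those of HOL-Algebra; their carriers are subsets of a type \<open>'m\<close>, which plays
  the role of the universe.  The \<open>mult\<close> and \<open>one\<close> fields which \<open>module\<close> records inherit
  from \<open>ring\<close> are never used.  Maps are extensional, i.e. \<open>undefined\<close> outside the carrier of
  their source, so that equality of maps of modules is equality of HOL functions.\<close>

definition lin_map ::
  "('a, 'r) ring_scheme \<Rightarrow> ('a, 'm, 's) module_scheme \<Rightarrow> ('a, 'n, 't) module_scheme \<Rightarrow> ('m \<Rightarrow> 'n) set"
  where
  "lin_map R M N = {f \<in> carrier M \<rightarrow>\<^sub>E carrier N.
     (\<forall>x \<in> carrier M. \<forall>y \<in> carrier M. f (x \<oplus>\<^bsub>M\<^esub> y) = f x \<oplus>\<^bsub>N\<^esub> f y) \<and>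
     (\<forall>a \<in> carrier R. \<forall>x \<in> carrier M. f (a \<odot>\<^bsub>M\<^esub> x) = a \<odot>\<^bsub>N\<^esub> f x)}"

definition lin_iso ::
  "('a, 'r) ring_scheme \<Rightarrow> ('a, 'm, 's) module_scheme \<Rightarrow> ('a, 'n, 't) module_scheme \<Rightarrow> ('m \<Rightarrow> 'n) set"
  where
  "lin_iso R M N = {f \<in> lin_map R M N. bij_betw f (carrier M) (carrier N)}"

definition finitely_generated :: "('a, 'r) ring_scheme \<Rightarrow> ('a, 'm, 's) module_scheme \<Rightarrow> bool" where
  "finitely_generated R M \<longleftrightarrow>
     (\<exists>S \<subseteq> carrier M. finite S \<and>
        (\<forall>x \<in> carrier M. \<exists>c \<in> S \<rightarrow> carrier R. x = (\<Oplus>\<^bsub>M\<^esub>s\<in>S. c s \<odot>\<^bsub>M\<^esub> s)))"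

text \<open>\<open>is_pushout R A B C f g P j k\<close>: the maps \<open>j : B \<rightarrow> P\<close> and \<open>k : C \<rightarrow> P\<close> form a pushout of
  \<open>f : A \<rightarrow> B\<close> and \<open>g : A \<rightarrow> C\<close>.  The universal property is tested on all modules of the universe.
  If \<open>'m\<close> is infinite, the universe contains copies of \<open>B \<times> C\<close> and of its quotients, so pushouts
  exist and agree with those in the category of all modules.\<close>

definition is_pushout ::
  "('a, 'r) ring_scheme \<Rightarrow> ('a, 'm, 's) module_scheme \<Rightarrow> ('a, 'm) module \<Rightarrow> ('a, 'm) module \<Rightarrow>
   ('m \<Rightarrow> 'm) \<Rightarrow> ('m \<Rightarrow> 'm) \<Rightarrow> ('a, 'm) module \<Rightarrow> ('m \<Rightarrow> 'm) \<Rightarrow> ('m \<Rightarrow> 'm) \<Rightarrow> bool" where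
  "is_pushout R A B C f g P j k \<longleftrightarrow>
     module R P \<and> j \<in> lin_map R B P \<and> k \<in> lin_map R C P \<and>
     compose (carrier A) j f = compose (carrier A) k g \<and>
     (\<forall>Q :: ('a, 'm) module. \<forall>p \<in> lin_map R B Q. \<forall>q \<in> lin_map R C Q.
        module R Q \<and> compose (carrier A) p f = compose (carrier A) q g \<longrightarrow>
        (\<exists>!u. u \<in> lin_map R P Q \<and>
              compose (carrier B) u j = p \<and> compose (carrier C) u k = q))"


section \<open>Hermitian modules and the categories $\mathbf{U}$ and $\mathbf{Lagr}$\<close>

record ('a, 'm) herm_module = "('a, 'm) module" +
  form :: "'m \<Rightarrow> 'm \<Rightarrow> 'a"

definition skew_hermitian_form ::
  "('a, 'r) ring_scheme \<Rightarrow> ('a \<Rightarrow> 'a) \<Rightarrow> ('a, 'm, 's) module_scheme \<Rightarrow> ('m \<Rightarrow> 'm \<Rightarrow> 'a) \<Rightarrow> bool" where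
  "skew_hermitian_form R bar M \<omega> \<longleftrightarrow>
     (\<forall>x \<in> carrier M. \<forall>y \<in> carrier M. \<omega> x y \<in> carrier R) \<and>
     (\<forall>a \<in> carrier R. \<forall>b \<in> carrier R. \<forall>x \<in> carrier M. \<forall>y \<in> carrier M. \<forall>z \<in> carrier M.
        \<omega> (a \<odot>\<^bsub>M\<^esub> x \<oplus>\<^bsub>M\<^esub> b \<odot>\<^bsub>M\<^esub> y) z = a \<otimes>\<^bsub>R\<^esub> \<omega> x z \<oplus>\<^bsub>R\<^esub> b \<otimes>\<^bsub>R\<^esub> \<omega> y z) \<and>
     (\<forall>x \<in> carrier M. \<forall>y \<in> carrier M. \<omega> x y = \<ominus>\<^bsub>R\<^esub> bar (\<omega> y x)) \<and>
     (\<forall>x \<in> carrier M. (\<forall>y \<in> carrier M. \<omega> x y = \<zero>\<^bsub>R\<^esub>) \<longrightarrow> x = \<zero>\<^bsub>M\<^esub>)"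

definition hermitian_module ::
  "('a, 'r) ring_scheme \<Rightarrow> ('a \<Rightarrow> 'a) \<Rightarrow> ('a, 'm) herm_module \<Rightarrow> bool" where
  "hermitian_module R bar H \<longleftrightarrow>
     module R H \<and> finitely_generated R H \<and> skew_hermitian_form R bar H (form H)"

definition herm_neg :: "('a, 'r) ring_scheme \<Rightarrow> ('a, 'm) herm_module \<Rightarrow> ('a, 'm) herm_module" where
  "herm_neg R H = H\<lparr>form := \<lambda>x y. \<ominus>\<^bsub>R\<^esub> form H x y\<rparr>"

definition herm_sum ::
  "('a, 'r) ring_scheme \<Rightarrow> ('a, 'm) herm_module \<Rightarrow> ('a, 'n) herm_module \<Rightarrow> ('a, 'm \<times> 'n) herm_module"
  where
  "herm_sum R H K =
     \<lparr>carrier = carrier H \<times> carrier K,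
      mult = undefined,
      one = undefined,
      zero = (\<zero>\<^bsub>H\<^esub>, \<zero>\<^bsub>K\<^esub>),
      add = (\<lambda>(x, y) (x', y'). (x \<oplus>\<^bsub>H\<^esub> x', y \<oplus>\<^bsub>K\<^esub> y')),
      smult = (\<lambda>a (x, y). (a \<odot>\<^bsub>H\<^esub> x, a \<odot>\<^bsub>K\<^esub> y)),
      form = (\<lambda>(x, y) (x', y'). form H x x' \<oplus>\<^bsub>R\<^esub> form K y y')\<rparr>"

definition annihilator :: "('a, 'r) ring_scheme \<Rightarrow> ('a, 'm) herm_module \<Rightarrow> 'm set \<Rightarrow> 'm set" where
  "annihilator R H A = {x \<in> carrier H. \<forall>v \<in> A. form H v x = \<zero>\<^bsub>R\<^esub>}"

definition lagrangian :: "('a, 'r) ring_scheme \<Rightarrow> ('a, 'm) herm_module \<Rightarrow> 'm set \<Rightarrow> bool" where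
  "lagrangian R H A \<longleftrightarrow> submodule A R H \<and> A = annihilator R H A"

definition torsion_closure ::
  "('a, 'r) ring_scheme \<Rightarrow> ('a, 'm, 's) module_scheme \<Rightarrow> 'm set \<Rightarrow> 'm set" where
  "torsion_closure R M A =
     {x \<in> carrier M. \<exists>a \<in> carrier R. a \<noteq> \<zero>\<^bsub>R\<^esub> \<and> a \<odot>\<^bsub>M\<^esub> x \<in> A}"

definition U_cat ::
  "('a, 'r) ring_scheme \<Rightarrow> ('a \<Rightarrow> 'a) \<Rightarrow> (('a, 'm) herm_module, 'm \<Rightarrow> 'm) cat" where
  "U_cat R bar =
     \<lparr>Obj = {H. hermitian_module R bar H},
      Hom = (\<lambda>H H'. {f \<in> lin_iso R H H'.
               \<forall>x \<in> carrier H. \<forall>y \<in> carrier H. form H' (f x) (f y) = form H x y}),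
      Comp = (\<lambda>H H' H'' g f. compose (carrier H) g f),
      Ident = (\<lambda>H. \<lambda>x\<in>carrier H. x)\<rparr>"

text \<open>A relation from \<open>H\<close> to \<open>H'\<close> is a set of pairs, so \<open>N\<^sub>2N\<^sub>1\<close> is the relational
  composite \<open>N\<^sub>1 O N\<^sub>2\<close>.\<close>

definition Lagr_cat ::
  "('a, 'r) ring_scheme \<Rightarrow> ('a \<Rightarrow> 'a) \<Rightarrow> (('a, 'm) herm_module, ('m \<times> 'm) set) cat" where
  "Lagr_cat R bar =
     \<lparr>Obj = {H. hermitian_module R bar H},
      Hom = (\<lambda>H H'. {N. lagrangian R (herm_sum R (herm_neg R H) H') N}),
      Comp = (\<lambda>H H' H'' N2 N1. torsion_closure R (herm_sum R (herm_neg R H) H'') (N1 O N2)),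
      Ident = (\<lambda>H. Id_on (carrier H))\<rparr>"

definition graph_functor ::
  "(('a, 'm) herm_module, 'm \<Rightarrow> 'm, ('a, 'm) herm_module, ('m \<times> 'm) set) cat_map" where
  "graph_functor =
     \<lparr>on_obj = (\<lambda>H. H), on_arr = (\<lambda>H H' f. {(x, f x) | x. x \<in> carrier H})\<rparr>"


section \<open>Cospans and the category $\mathbf{L}$\<close>

record ('a, 'm) cospan =
  apex :: "('a, 'm) module"
  lleg :: "'m \<Rightarrow> 'm"
  rleg :: "'m \<Rightarrow> 'm"

definition is_cospan ::
  "('a, 'r) ring_scheme \<Rightarrow> ('a, 'm, 's) module_scheme \<Rightarrow> ('a, 'm, 's) module_scheme \<Rightarrow>
   ('a, 'm) cospan \<Rightarrow> bool" where
  "is_cospan R H H' T \<longleftrightarrow>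
     module R (apex T) \<and> lleg T \<in> lin_map R H (apex T) \<and> rleg T \<in> lin_map R H' (apex T)"

definition cospan_isomorphic ::
  "('a, 'r) ring_scheme \<Rightarrow> ('a, 'm, 's) module_scheme \<Rightarrow> ('a, 'm, 's) module_scheme \<Rightarrow>
   ('a, 'm) cospan \<Rightarrow> ('a, 'm) cospan \<Rightarrow> bool" where
  "cospan_isomorphic R H H' T1 T2 \<longleftrightarrow>
     (\<exists>f \<in> lin_iso R (apex T1) (apex T2).
        compose (carrier H) f (lleg T1) = lleg T2 \<and> compose (carrier H') f (rleg T1) = rleg T2)"

definition cospan_class ::
  "('a, 'r) ring_scheme \<Rightarrow> ('a, 'm, 's) module_scheme \<Rightarrow> ('a, 'm, 's) module_scheme \<Rightarrow>
   ('a, 'm) cospan \<Rightarrow> ('a, 'm) cospan set" where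
  "cospan_class R H H' T = {S. is_cospan R H H' S \<and> cospan_isomorphic R H H' T S}"

definition cospan_rel ::
  "('a, 'm, 's) module_scheme \<Rightarrow> ('a, 'm, 's) module_scheme \<Rightarrow> ('a, 'm) cospan \<Rightarrow> ('m \<times> 'm) set" where
  "cospan_rel H H' T = {(x, y). x \<in> carrier H \<and> y \<in> carrier H' \<and> rleg T y = lleg T x}"

definition cospan_rel_closure ::
  "('a, 'r) ring_scheme \<Rightarrow> ('a, 'm) herm_module \<Rightarrow> ('a, 'm) herm_module \<Rightarrow>
   ('a, 'm) cospan \<Rightarrow> ('m \<times> 'm) set" where
  "cospan_rel_closure R H H' T =
     torsion_closure R (herm_sum R (herm_neg R H) H') (cospan_rel H H' T)"

definition lagrangian_cospan ::
  "('a, 'r) ring_scheme \<Rightarrow> ('a \<Rightarrow> 'a) \<Rightarrow> ('a, 'm) herm_module \<Rightarrow> ('a, 'm) herm_module \<Rightarrow>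
   ('a, 'm) cospan \<Rightarrow> bool" where
  "lagrangian_cospan R bar H H' T \<longleftrightarrow>
     is_cospan R H H' T \<and> hermitian_module R bar H \<and> hermitian_module R bar H' \<and>
     lagrangian R (herm_sum R (herm_neg R H) H') (cospan_rel_closure R H H' T)"

definition invertible_cospan ::
  "('a, 'r) ring_scheme \<Rightarrow> ('a, 'm, 's) module_scheme \<Rightarrow> ('a, 'm, 's) module_scheme \<Rightarrow>
   ('a, 'm) cospan \<Rightarrow> bool" where
  "invertible_cospan R H H' T \<longleftrightarrow>
     is_cospan R H H' T \<and> lleg T \<in> lin_iso R H (apex T) \<and> rleg T \<in> lin_iso R H' (apex T)"

definition id_cospan :: "('a, 'm) herm_module \<Rightarrow> ('a, 'm) cospan" where
  "id_cospan H =
     \<lparr>apex = module.truncate H, lleg = (\<lambda>x\<in>carrier H. x), rleg = (\<lambda>x\<in>carrier H. x)\<rparr>"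

text \<open>Composition of isomorphism classes is defined without choosing representatives or pushouts:
  the composite consists of all cospans obtained from some representatives and some pushout.
  As pushouts are unique up to isomorphism, and every module isomorphic to a pushout is one,
  this is a full isomorphism class of cospans.\<close>

definition comp_cospan_class ::
  "('a, 'r) ring_scheme \<Rightarrow> ('a, 'm) herm_module \<Rightarrow> ('a, 'm) herm_module \<Rightarrow> ('a, 'm) herm_module \<Rightarrow>
   ('a, 'm) cospan set \<Rightarrow> ('a, 'm) cospan set \<Rightarrow> ('a, 'm) cospan set" where
  "comp_cospan_class R H H' H'' c2 c1 =
     {\<lparr>apex = P, lleg = compose (carrier H) j1 (lleg T1), rleg = compose (carrier H'') j2 (rleg T2)\<rparr>
      | P j1 j2 T1 T2. T1 \<in> c1 \<and> T2 \<in> c2 \<and>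
          is_pushout R H' (apex T1) (apex T2) (rleg T1) (lleg T2) P j1 j2}"

definition L_cat ::
  "('a, 'r) ring_scheme \<Rightarrow> ('a \<Rightarrow> 'a) \<Rightarrow> (('a, 'm) herm_module, ('a, 'm) cospan set) cat" where
  "L_cat R bar =
     \<lparr>Obj = {H. hermitian_module R bar H},
      Hom = (\<lambda>H H'. {cospan_class R H H' T | T. lagrangian_cospan R bar H H' T}),
      Comp = comp_cospan_class R,
      Ident = (\<lambda>H. cospan_class R H H (id_cospan H))\<rparr>"

lemma cospan_rel_isomorphic:
  assumes "is_cospan R H H' T1" "cospan_isomorphic R H H' T1 T2"
  shows "cospan_rel H H' T1 = cospan_rel H H' T2"
proof -
  obtain f where f: "inj_on f (carrier (apex T1))"
      "compose (carrier H) f (lleg T1) = lleg T2" "compose (carrier H') f (rleg T1) = rleg T2"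
    using assms(2) unfolding cospan_isomorphic_def lin_iso_def bij_betw_def by blast
  have "lleg T2 x = f (lleg T1 x)" if "x \<in> carrier H" for x
    using f(2) that by (metis compose_eq)
  moreover have "rleg T2 y = f (rleg T1 y)" if "y \<in> carrier H'" for y
    using f(3) that by (metis compose_eq)
  moreover have "lleg T1 x \<in> carrier (apex T1)" if "x \<in> carrier H" for x
    using assms(1) that unfolding is_cospan_def lin_map_def by blast
  moreover have "rleg T1 y \<in> carrier (apex T1)" if "y \<in> carrier H'" for y
    using assms(1) that unfolding is_cospan_def lin_map_def by blast
  ultimately show ?thesis
    using f(1) unfolding cospan_rel_def by (auto simp: inj_on_eq_iff)
qed

text \<open>By the preceding lemma, the value below does not depend on the representative.\<close>

definition F_functor ::
  "('a, 'r) ring_scheme \<Rightarrow>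
   (('a, 'm) herm_module, ('a, 'm) cospan set, ('a, 'm) herm_module, ('m \<times> 'm) set) cat_map" where
  "F_functor R =
     \<lparr>on_obj = (\<lambda>H. H),
      on_arr = (\<lambda>H H' c. cospan_rel_closure R H H' (SOME T. T \<in> c))\<rparr>"

definition cospan_map ::
  "('a, 'm, 's) module_scheme \<Rightarrow> ('a, 'm, 's) module_scheme \<Rightarrow> ('a, 'm) cospan \<Rightarrow> ('m \<Rightarrow> 'm)" where
  "cospan_map H H' T = compose (carrier H) (inv_into (carrier H') (rleg T)) (lleg T)"

definition core_functor ::
  "(('a, 'm) herm_module, ('a, 'm) cospan set, ('a, 'm) herm_module, 'm \<Rightarrow> 'm) cat_map" where
  "core_functor =
     \<lparr>on_obj = (\<lambda>H. H), on_arr = (\<lambda>H H' c. cospan_map H H' (SOME T. T \<in> c))\<rparr>"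

end

theory Submission
  imports Defs
begin

text \<open>
  An invertible cospan \<open>H \<rightarrow> T \<leftarrow> H'\<close> with legs \<open>i\<close> and \<open>i'\<close> carries no more information than
  the isomorphism \<open>\<phi> = i'\<^sup>-\<^sup>1 i\<close>: the map \<open>i'\<^sup>-\<^sup>1\<close> identifies it with the cospan
  \<open>H \<rightarrow> H' \<leftarrow> H'\<close> whose legs are \<open>\<phi>\<close> and the identity (\<open>cospan_class_eq_map_cospan\<close>).  For cospans
  of this shape the pushout defining the composite is taken along an identity, so cospans compose
  as the maps do (\<open>comp_map_cospan\<close>).  Invertible Lagrangian cospans up to isomorphism therefore
  form the same category as the maps \<open>\<phi>\<close> that arise, and the functor from the core is the identity
  on objects and bijective on hom-sets (\<open>equivalence_by_transport\<close>).  Two points remain.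

  The maps that arise are the unitary isomorphisms.  The relation \<open>N\<^sub>T\<close> of an invertible cospan is
  the graph of \<open>\<phi>\<close>, and a Hermitian module over a domain is torsion-free since its form is
  non-degenerate, so the graph is its own closure (\<open>torsion_closure_graph\<close>).  It lies in its
  annihilator exactly if \<open>\<phi>\<close> preserves the forms, and then non-degeneracy on \<open>H'\<close> together with
  surjectivity of \<open>\<phi>\<close> gives the reverse inclusion (\<open>lagrangian_graph_iff_unitary\<close>).  That \<open>F\<close>
  takes the cospan to the graph of \<open>\<phi>\<close> is the commutativity of the square.

  Every isomorphism of \<open>\<^bold>L\<close> is invertible as a cospan.  If \<open>T\<close> and \<open>T'\<close> are inverse to each
  other, then the two composites contain the identity cospans, so that all four legs are split
  monomorphisms.  A pushout of a split monomorphism is a split monomorphism, by the universal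
  property alone and hence independently of the size of the universe in which pushouts are formed
  (\<open>pushout_of_split_mono\<close>).  Thus the map \<open>j\<close> from \<open>T\<close> to the pushout is injective; as \<open>j i\<close> is
  an identity, \<open>j\<close> is bijective with inverse \<open>i\<close> (\<open>inverse_classes_imp_invertible\<close>).
\<close>

section \<open>Linear maps\<close>

lemma lin_mapI:
  assumes "f \<in> carrier M \<rightarrow>\<^sub>E carrier N"
    and "\<And>x y. \<lbrakk>x \<in> carrier M; y \<in> carrier M\<rbrakk> \<Longrightarrow> f (x \<oplus>\<^bsub>M\<^esub> y) = f x \<oplus>\<^bsub>N\<^esub> f y"
    and "\<And>a x. \<lbrakk>a \<in> carrier R; x \<in> carrier M\<rbrakk> \<Longrightarrow> f (a \<odot>\<^bsub>M\<^esub> x) = a \<odot>\<^bsub>N\<^esub> f x"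
  shows "f \<in> lin_map R M N"
  using assms unfolding lin_map_def by blast

lemma lin_mapD:
  assumes "f \<in> lin_map R M N"
  shows "f \<in> carrier M \<rightarrow> carrier N" "f \<in> extensional (carrier M)"
    and "x \<in> carrier M \<Longrightarrow> f x \<in> carrier N"
    and "\<lbrakk>x \<in> carrier M; y \<in> carrier M\<rbrakk> \<Longrightarrow> f (x \<oplus>\<^bsub>M\<^esub> y) = f x \<oplus>\<^bsub>N\<^esub> f y"
    and "\<lbrakk>a \<in> carrier R; x \<in> carrier M\<rbrakk> \<Longrightarrow> f (a \<odot>\<^bsub>M\<^esub> x) = a \<odot>\<^bsub>N\<^esub> f x"
  using assms unfolding lin_map_def PiE_def by auto

lemma lin_isoD:
  assumes "f \<in> lin_iso R M N"
  shows "f \<in> lin_map R M N" "bij_betw f (carrier M) (carrier N)"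
    "inj_on f (carrier M)" "f ` carrier M = carrier N"
  using assms unfolding lin_iso_def bij_betw_def by auto

lemma module_add_closed:
  "\<lbrakk>module R M; x \<in> carrier M; y \<in> carrier M\<rbrakk> \<Longrightarrow> x \<oplus>\<^bsub>M\<^esub> y \<in> carrier M"
  by (simp add: module_def abelian_group_def abelian_monoid.a_closed)

lemma lin_map_compose:
  assumes "module R A" "f \<in> lin_map R A B" "g \<in> lin_map R B C"
  shows "compose (carrier A) g f \<in> lin_map R A C"
proof (rule lin_mapI)
  show "compose (carrier A) g f \<in> carrier A \<rightarrow>\<^sub>E carrier C"
    using lin_mapD(3)[OF assms(2)] lin_mapD(3)[OF assms(3)] by (auto simp: compose_def)
qed (simp_all add: compose_def module_add_closed[OF assms(1)] module.smult_closed[OF assms(1)]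
      lin_mapD(3-5)[OF assms(2)] lin_mapD(3-5)[OF assms(3)])

lemma lin_map_id: "module R M \<Longrightarrow> (\<lambda>x\<in>carrier M. x) \<in> lin_map R M M"
  by (rule lin_mapI) (auto simp: module_add_closed module.smult_closed)

lemma lin_iso_id: "module R M \<Longrightarrow> (\<lambda>x\<in>carrier M. x) \<in> lin_iso R M M"
  unfolding lin_iso_def by (simp add: lin_map_id bij_betw_def inj_on_def)

lemma lin_iso_compose:
  assumes "module R A" "f \<in> lin_iso R A B" "g \<in> lin_iso R B C"
  shows "compose (carrier A) g f \<in> lin_iso R A C"
  using lin_map_compose[OF assms(1) lin_isoD(1)[OF assms(2)] lin_isoD(1)[OF assms(3)]]
    bij_betw_compose[OF lin_isoD(2)[OF assms(2)] lin_isoD(2)[OF assms(3)]]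
  unfolding lin_iso_def by blast

definition lin_inverse ::
  "('a, 'm, 's) module_scheme \<Rightarrow> ('a, 'n, 't) module_scheme \<Rightarrow> ('m \<Rightarrow> 'n) \<Rightarrow> 'n \<Rightarrow> 'm" where
  "lin_inverse A B f = (\<lambda>y\<in>carrier B. inv_into (carrier A) f y)"

lemma lin_inverse_left:
  "f \<in> lin_iso R A B \<Longrightarrow> compose (carrier A) (lin_inverse A B f) f = (\<lambda>x\<in>carrier A. x)"
  unfolding lin_inverse_def by (rule compose_inv_into_id[OF lin_isoD(2)])

lemma lin_inverse_right:
  "f \<in> lin_iso R A B \<Longrightarrow> compose (carrier B) f (lin_inverse A B f) = (\<lambda>x\<in>carrier B. x)"
  unfolding lin_inverse_def by (rule compose_id_inv_into[OF lin_isoD(4)])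

lemma lin_iso_inverse:
  assumes "module R A" "f \<in> lin_iso R A B"
  shows "lin_inverse A B f \<in> lin_iso R B A"
proof -
  note f = lin_mapD[OF lin_isoD(1)[OF assms(2)]] and b = lin_isoD[OF assms(2)]
  have inv: "inv_into (carrier A) f y \<in> carrier A" "f (inv_into (carrier A) f y) = y"
    if "y \<in> carrier B" for y
    using that b(4) by (auto simp: inv_into_into f_inv_into_f)
  have uniq: "inv_into (carrier A) f (f x) = x" if "x \<in> carrier A" for x
    using that b(3) by simp
  have "inv_into (carrier A) f (x \<oplus>\<^bsub>B\<^esub> y) = inv_into (carrier A) f x \<oplus>\<^bsub>A\<^esub> inv_into (carrier A) f y"
    if "x \<in> carrier B" "y \<in> carrier B" for x y
    using uniq[of "inv_into (carrier A) f x \<oplus>\<^bsub>A\<^esub> inv_into (carrier A) f y"] that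
    by (simp add: inv f(4) module_add_closed[OF assms(1)])
  moreover have "x \<oplus>\<^bsub>B\<^esub> y \<in> carrier B" if "x \<in> carrier B" "y \<in> carrier B" for x y
    using f(3)[of "inv_into (carrier A) f x \<oplus>\<^bsub>A\<^esub> inv_into (carrier A) f y"] that
    by (simp add: inv f(4) module_add_closed[OF assms(1)])
  moreover have "inv_into (carrier A) f (a \<odot>\<^bsub>B\<^esub> x) = a \<odot>\<^bsub>A\<^esub> inv_into (carrier A) f x"
    if "a \<in> carrier R" "x \<in> carrier B" for a x
    using uniq[of "a \<odot>\<^bsub>A\<^esub> inv_into (carrier A) f x"] that
    by (simp add: inv f(5) module.smult_closed[OF assms(1)])
  moreover have "a \<odot>\<^bsub>B\<^esub> x \<in> carrier B" if "a \<in> carrier R" "x \<in> carrier B" for a x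
    using f(3)[of "a \<odot>\<^bsub>A\<^esub> inv_into (carrier A) f x"] that
    by (simp add: inv f(5) module.smult_closed[OF assms(1)])
  ultimately have "lin_inverse A B f \<in> lin_map R B A"
    unfolding lin_inverse_def using inv by (intro lin_mapI) auto
  moreover have "bij_betw (lin_inverse A B f) (carrier B) (carrier A)"
    unfolding lin_inverse_def using bij_betw_inv_into[OF b(2)]
    by (subst bij_betw_cong[where g = "inv_into (carrier A) f"]) auto
  ultimately show ?thesis
    unfolding lin_iso_def by blast
qed

lemma lin_map_compose_assoc:
  assumes "f \<in> lin_map R A B"
  shows "compose (carrier A) h (compose (carrier A) g f)
    = compose (carrier A) (compose (carrier B) h g) f"
  using compose_assoc[OF lin_mapD(1)[OF assms]] .

lemma lin_map_compose_id:
  assumes "f \<in> lin_map R A B"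
  shows "compose (carrier A) (\<lambda>y\<in>carrier B. y) f = f"
    and "compose (carrier A) f (\<lambda>x\<in>carrier A. x) = f"
  using Id_compose[OF lin_mapD(1,2)[OF assms]] compose_Id[OF lin_mapD(1,2)[OF assms]] by auto

text \<open>An injective retraction is a two-sided inverse.\<close>

lemma retraction_imp_iso:
  assumes "i \<in> lin_map R A B" "j \<in> lin_map R B A" "inj_on j (carrier B)"
    and "compose (carrier A) j i = (\<lambda>x\<in>carrier A. x)"
  shows "i \<in> lin_iso R A B"
proof -
  have ji: "j (i x) = x" if "x \<in> carrier A" for x
    using assms(4) that by (metis compose_eq restrict_apply')
  have "inj_on i (carrier A)"
    using ji by (metis inj_onI)
  moreover have "i ` carrier A = carrier B"
  proof (intro equalityI subsetI)
    fix t assume t: "t \<in> carrier B"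
    then have jt: "j t \<in> carrier A"
      by (rule lin_mapD(3)[OF assms(2)])
    then have "i (j t) = t"
      using ji[OF jt] t lin_mapD(3)[OF assms(1) jt] assms(3) by (simp add: inj_on_eq_iff)
    then show "t \<in> i ` carrier A"
      using jt by (metis imageI)
  qed (use lin_mapD(3)[OF assms(1)] in auto)
  ultimately show ?thesis
    using assms(1) unfolding lin_iso_def bij_betw_def by blast
qed

text \<open>Transfers the module axioms between records of different types, in particular between a
  Hermitian module, its negative, and its underlying module.\<close>

lemma module_cong:
  fixes M :: "('a, 'm, 's) module_scheme" and N :: "('a, 'm, 't) module_scheme"
  assumes "module R M" "carrier N = carrier M" "add N = add M" "zero N = zero M"
    "smult N = smult M"
  shows "module R N"
proof -
  interpret module R M by fact
  show ?thesis
  proof (rule moduleI[OF is_cring])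
    show "abelian_group N"
    proof (rule abelian_groupI)
      show "\<exists>y\<in>carrier N. y \<oplus>\<^bsub>N\<^esub> x = \<zero>\<^bsub>N\<^esub>" if "x \<in> carrier N" for x
        using that M.l_neg M.a_inv_closed by (auto simp: assms)
    qed (auto simp: assms M.a_assoc intro: M.a_comm)
  qed (auto simp: assms smult_l_distr smult_r_distr smult_assoc1)
qed

lemma truncate_simps [simp]:
  "carrier (module.truncate M) = carrier M" "add (module.truncate M) = add M"
  "zero (module.truncate M) = zero M" "smult (module.truncate M) = smult M"
  by (simp_all add: module.truncate_def)

lemma module_truncate: "module R M \<Longrightarrow> module R (module.truncate M)"
  by (rule module_cong[of R M]) (simp_all only: truncate_simps)

lemma lin_map_truncate [simp]:
  "lin_map R (module.truncate M) N = lin_map R M N"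
  "lin_map R M' (module.truncate N') = lin_map R M' N'"
  by (simp_all only: lin_map_def truncate_simps)

lemma lin_iso_truncate [simp]:
  "lin_iso R (module.truncate M) N = lin_iso R M N"
  "lin_iso R M' (module.truncate N') = lin_iso R M' N'"
  by (simp_all only: lin_iso_def truncate_simps lin_map_truncate)

section \<open>Pushouts\<close>

text \<open>Splits the unique factorisation into existence and joint cancellation, which are easier to
  transport along isomorphisms separately.\<close>

lemma is_pushoutI:
  fixes B C P :: "('a, 'm) module"
  assumes "module R P" "j \<in> lin_map R B P" "k \<in> lin_map R C P"
    and "compose (carrier A) j f = compose (carrier A) k g"
    and ex: "\<And>(Q :: ('a, 'm) module) p q. \<lbrakk>module R Q; p \<in> lin_map R B Q; q \<in> lin_map R C Q;
        compose (carrier A) p f = compose (carrier A) q g\<rbrakk>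
      \<Longrightarrow> \<exists>u \<in> lin_map R P Q. compose (carrier B) u j = p \<and> compose (carrier C) u k = q"
    and uniq: "\<And>(Q :: ('a, 'm) module) u v. \<lbrakk>module R Q; u \<in> lin_map R P Q; v \<in> lin_map R P Q;
        compose (carrier B) u j = compose (carrier B) v j;
        compose (carrier C) u k = compose (carrier C) v k\<rbrakk> \<Longrightarrow> u = v"
  shows "is_pushout R A B C f g P j k"
  unfolding is_pushout_def
proof (intro conjI allI ballI impI)
  fix Q :: "('a, 'm) module" and p q
  assume pq: "p \<in> lin_map R B Q" "q \<in> lin_map R C Q"
    and *: "module R Q \<and> compose (carrier A) p f = compose (carrier A) q g"
  obtain u where u: "u \<in> lin_map R P Q" "compose (carrier B) u j = p" "compose (carrier C) u k = q"
    using ex[OF _ pq] * by auto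
  show "\<exists>!u. u \<in> lin_map R P Q \<and> compose (carrier B) u j = p \<and> compose (carrier C) u k = q"
  proof (rule ex1I[of _ u])
    fix v assume "v \<in> lin_map R P Q \<and> compose (carrier B) v j = p \<and> compose (carrier C) v k = q"
    then show "v = u"
      using u * by - (rule uniq[of Q v u], simp_all)
  qed (use u in simp)
qed (use assms(1-4) in simp_all)

lemma is_pushoutD:
  assumes "is_pushout R A B C f g P j k"
  shows "module R P" "j \<in> lin_map R B P" "k \<in> lin_map R C P"
    "compose (carrier A) j f = compose (carrier A) k g"
  using assms unfolding is_pushout_def by auto

lemma pushout_universal:
  fixes B C Q :: "('a, 'm) module"
  assumes "is_pushout R A B C f g P j k" "module R Q" "p \<in> lin_map R B Q" "q \<in> lin_map R C Q"
    and "compose (carrier A) p f = compose (carrier A) q g"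
  shows "\<exists>!u. u \<in> lin_map R P Q \<and> compose (carrier B) u j = p \<and> compose (carrier C) u k = q"
  using assms unfolding is_pushout_def by simp

lemma pushout_map_exists:
  fixes B C Q :: "('a, 'm) module"
  assumes "is_pushout R A B C f g P j k" "module R Q" "p \<in> lin_map R B Q" "q \<in> lin_map R C Q"
    and "compose (carrier A) p f = compose (carrier A) q g"
  obtains u where "u \<in> lin_map R P Q" "compose (carrier B) u j = p" "compose (carrier C) u k = q"
  using ex1_implies_ex[OF pushout_universal[OF assms]] by (elim exE conjE) (rule that)

lemma pushout_map_eq:
  fixes B C Q :: "('a, 'm) module"
  assumes po: "is_pushout R A B C f g P j k" and mods: "module R B" "module R C" "module R Q"
    and f: "f \<in> lin_map R A B" and g: "g \<in> lin_map R A C"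
    and u: "u \<in> lin_map R P Q" and v: "v \<in> lin_map R P Q"
    and eq: "compose (carrier B) u j = compose (carrier B) v j"
      "compose (carrier C) u k = compose (carrier C) v k"
  shows "u = v"
proof -
  note P = is_pushoutD[OF po]
  have "compose (carrier A) (compose (carrier B) v j) f = compose (carrier A) (compose (carrier C) v k) g"
    using P(4) lin_map_compose_assoc[OF f, of v j] lin_map_compose_assoc[OF g, of v k] by simp
  from pushout_universal[OF po mods(3) lin_map_compose[OF mods(1) P(2) v]
      lin_map_compose[OF mods(2) P(3) v] this]
  obtain w where w: "\<forall>y. y \<in> lin_map R P Q \<and> compose (carrier B) y j = compose (carrier B) v j
      \<and> compose (carrier C) y k = compose (carrier C) v k \<longrightarrow> y = w"
    by (rule ex1E)
  show ?thesis
    using w[THEN spec, of u] w[THEN spec, of v] u v eq by simp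
qed

lemma is_pushout_sym:
  fixes B C P :: "('a, 'm) module"
  assumes po: "is_pushout R A B C f g P j k" and mods: "module R B" "module R C"
    and f: "f \<in> lin_map R A B" and g: "g \<in> lin_map R A C"
  shows "is_pushout R A C B g f P k j"
proof (rule is_pushoutI)
  fix Q :: "('a, 'm) module" and p q
  assume Q: "module R Q" and p: "p \<in> lin_map R C Q" and q: "q \<in> lin_map R B Q"
    and eq: "compose (carrier A) p g = compose (carrier A) q f"
  obtain u where "u \<in> lin_map R P Q" "compose (carrier B) u j = q" "compose (carrier C) u k = p"
    by (rule pushout_map_exists[OF po Q q p eq[symmetric]])
  then show "\<exists>u \<in> lin_map R P Q. compose (carrier C) u k = p \<and> compose (carrier B) u j = q"
    by (intro bexI[of _ u] conjI)
next
  fix Q :: "('a, 'm) module" and u v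
  assume Q: "module R Q" "u \<in> lin_map R P Q" "v \<in> lin_map R P Q"
    and eq: "compose (carrier C) u k = compose (carrier C) v k"
    "compose (carrier B) u j = compose (carrier B) v j"
  show "u = v"
    by (rule pushout_map_eq[OF po mods Q(1) f g Q(2,3) eq(2,1)])
qed (use is_pushoutD[OF po] in simp_all)

lemma pushout_of_identity:
  fixes A :: "('a, 'm, 's) module_scheme" and C :: "('a, 'm) module"
  assumes "module R A" "module R C" and g: "g \<in> lin_map R A C"
  shows "is_pushout R A (module.truncate A) C (\<lambda>x\<in>carrier A. x) g C g (\<lambda>y\<in>carrier C. y)"
proof (rule is_pushoutI)
  show "compose (carrier A) g (\<lambda>x\<in>carrier A. x) = compose (carrier A) (\<lambda>y\<in>carrier C. y) g"
    using lin_map_compose_id[OF g] by simp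
next
  fix Q :: "('a, 'm) module" and p q
  assume p: "p \<in> lin_map R (module.truncate A) Q" and q: "q \<in> lin_map R C Q"
    and *: "compose (carrier A) p (\<lambda>x\<in>carrier A. x) = compose (carrier A) q g"
  have "compose (carrier (module.truncate A)) q g = p"
    using lin_map_compose_id(2)[OF p] * by simp
  then show "\<exists>u \<in> lin_map R C Q. compose (carrier (module.truncate A)) u g = p
      \<and> compose (carrier C) u (\<lambda>y\<in>carrier C. y) = q"
    using q lin_map_compose_id(2)[OF q] by (intro bexI[of _ q] conjI)
next
  fix Q :: "('a, 'm) module" and u v
  assume "u \<in> lin_map R C Q" "v \<in> lin_map R C Q"
    "compose (carrier C) u (\<lambda>y\<in>carrier C. y) = compose (carrier C) v (\<lambda>y\<in>carrier C. y)"
  then show "u = v"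
    using lin_map_compose_id(2)[of u R C Q] lin_map_compose_id(2)[of v R C Q] by simp
qed (use assms lin_map_id[OF assms(2)] in simp_all)

text \<open>The identity of \<open>B\<close> and the map \<open>f r\<close> agree on \<open>A\<close>, hence factor through the pushout; the
  induced map is a retraction of \<open>j\<close>.  Testing the universal property on \<open>B\<close> itself avoids any
  construction of the pushout as a quotient of \<open>B \<oplus> C\<close>.\<close>

lemma pushout_of_split_mono:
  fixes B C :: "('a, 'm) module"
  assumes po: "is_pushout R A B C f g P j k" and mods: "module R B" "module R C"
    and f: "f \<in> lin_map R A B" and g: "g \<in> lin_map R A C"
    and r: "r \<in> lin_map R C A" "compose (carrier A) r g = (\<lambda>x\<in>carrier A. x)"
  shows "inj_on j (carrier B)"
proof -
  have "compose (carrier A) (\<lambda>x\<in>carrier B. x) f = compose (carrier A) (compose (carrier C) f r) g"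
    using lin_map_compose_id[OF f] r(2) lin_map_compose_assoc[OF g, of f r] by simp
  then obtain u where "u \<in> lin_map R P B" and u: "compose (carrier B) u j = (\<lambda>x\<in>carrier B. x)"
      and "compose (carrier C) u k = compose (carrier C) f r"
    by (rule pushout_map_exists[OF po mods(1) lin_map_id[OF mods(1)] lin_map_compose[OF mods(2) r(1) f]])
  show ?thesis
  proof (rule inj_on_inverseI)
    show "u (j x) = x" if "x \<in> carrier B" for x
      using fun_cong[OF u, of x] that by (simp add: compose_eq)
  qed
qed

lemma lin_iso_cancel_right:
  assumes "module R B" "b \<in> lin_iso R B B'" "v \<in> lin_map R B' Q" "p \<in> lin_map R B Q"
  shows "compose (carrier B) v b = p \<longleftrightarrow> v = compose (carrier B') p (lin_inverse B B' b)"
proof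
  assume "compose (carrier B) v b = p"
  then have "compose (carrier B') p (lin_inverse B B' b) =
      compose (carrier B') v (compose (carrier B') b (lin_inverse B B' b))"
    using lin_map_compose_assoc[OF lin_isoD(1)[OF lin_iso_inverse[OF assms(1,2)]], of v b] by simp
  then show "v = compose (carrier B') p (lin_inverse B B' b)"
    using lin_inverse_right[OF assms(2)] lin_map_compose_id(2)[OF assms(3)] by simp
next
  assume "v = compose (carrier B') p (lin_inverse B B' b)"
  then show "compose (carrier B) v b = p"
    using lin_map_compose_assoc[OF lin_isoD(1)[OF assms(2)], of p "lin_inverse B B' b"]
      lin_inverse_left[OF assms(2)] lin_map_compose_id(2)[OF assms(4)] by simp
qed

lemma lin_iso_epi:
  assumes "module R B" "b \<in> lin_iso R B B'" "u \<in> lin_map R B' Q" "v \<in> lin_map R B' Q"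
    and "compose (carrier B) u b = compose (carrier B) v b"
  shows "u = v"
  using lin_iso_cancel_right[OF assms(1-3) lin_map_compose[OF assms(1) lin_isoD(1)[OF assms(2)] assms(4)]]
    lin_iso_cancel_right[OF assms(1,2,4) lin_map_compose[OF assms(1) lin_isoD(1)[OF assms(2)] assms(4)]]
    assms(5) by simp

text \<open>Composites of classes allow any representatives of the two factors; this moves a pushout
  taken over other representatives \<open>B'\<close>, \<open>C'\<close> back to the given ones.\<close>

lemma is_pushout_change_span:
  fixes B B' C C' :: "('a, 'm) module"
  assumes po: "is_pushout R A B' C' (compose (carrier A) b f) (compose (carrier A) c g) P j k"
    and A: "module R A"
    and mods: "module R B" "module R C" and mods': "module R B'" "module R C'"
    and b: "b \<in> lin_iso R B B'" and c: "c \<in> lin_iso R C C'"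
    and f: "f \<in> lin_map R A B" and g: "g \<in> lin_map R A C"
  shows "is_pushout R A B C f g P (compose (carrier B) j b) (compose (carrier C) k c)"
proof (rule is_pushoutI)
  note P = is_pushoutD[OF po] and bl = lin_isoD(1)[OF b] and cl = lin_isoD(1)[OF c]
  note b' = lin_isoD(1)[OF lin_iso_inverse[OF mods(1) b]]
    and c' = lin_isoD(1)[OF lin_iso_inverse[OF mods(2) c]]
  show "module R P" by (rule P(1))
  show "compose (carrier B) j b \<in> lin_map R B P" by (rule lin_map_compose[OF mods(1) bl P(2)])
  show "compose (carrier C) k c \<in> lin_map R C P" by (rule lin_map_compose[OF mods(2) cl P(3)])
  show "compose (carrier A) (compose (carrier B) j b) f = compose (carrier A) (compose (carrier C) k c) g"
    using P(4) lin_map_compose_assoc[OF f, of j b] lin_map_compose_assoc[OF g, of k c] by simp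
  {
    fix Q :: "('a, 'm) module" and p q
    assume Q: "module R Q" and p: "p \<in> lin_map R B Q" and q: "q \<in> lin_map R C Q"
      and eq: "compose (carrier A) p f = compose (carrier A) q g"
    let ?p = "compose (carrier B') p (lin_inverse B B' b)"
      and ?q = "compose (carrier C') q (lin_inverse C C' c)"
    have p': "?p \<in> lin_map R B' Q" by (rule lin_map_compose[OF mods'(1) b' p])
    have q': "?q \<in> lin_map R C' Q" by (rule lin_map_compose[OF mods'(2) c' q])
    have pb: "compose (carrier B) ?p b = p" using lin_iso_cancel_right[OF mods(1) b p' p] by simp
    have qc: "compose (carrier C) ?q c = q" using lin_iso_cancel_right[OF mods(2) c q' q] by simp
    have "compose (carrier A) ?p (compose (carrier A) b f) = compose (carrier A) ?q (compose (carrier A) c g)"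
      using eq pb qc lin_map_compose_assoc[OF f, of ?p b] lin_map_compose_assoc[OF g, of ?q c] by simp
    then obtain u where u: "u \<in> lin_map R P Q" "compose (carrier B') u j = ?p" "compose (carrier C') u k = ?q"
      by (rule pushout_map_exists[OF po Q p' q'])
    then show "\<exists>u \<in> lin_map R P Q. compose (carrier B) u (compose (carrier B) j b) = p
        \<and> compose (carrier C) u (compose (carrier C) k c) = q"
      using pb qc lin_map_compose_assoc[OF bl, of u j] lin_map_compose_assoc[OF cl, of u k]
      by (intro bexI[of _ u] conjI) simp_all
  next
    fix Q :: "('a, 'm) module" and u v
    assume Q: "module R Q" and u: "u \<in> lin_map R P Q" and v: "v \<in> lin_map R P Q"
      and eq: "compose (carrier B) u (compose (carrier B) j b) = compose (carrier B) v (compose (carrier B) j b)"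
        "compose (carrier C) u (compose (carrier C) k c) = compose (carrier C) v (compose (carrier C) k c)"
    have "compose (carrier B') u j = compose (carrier B') v j"
      using eq(1) lin_map_compose_assoc[OF bl, of u j] lin_map_compose_assoc[OF bl, of v j]
      by - (rule lin_iso_epi[OF mods(1) b lin_map_compose[OF mods'(1) P(2) u]
            lin_map_compose[OF mods'(1) P(2) v]], simp)
    moreover have "compose (carrier C') u k = compose (carrier C') v k"
      using eq(2) lin_map_compose_assoc[OF cl, of u k] lin_map_compose_assoc[OF cl, of v k]
      by - (rule lin_iso_epi[OF mods(2) c lin_map_compose[OF mods'(2) P(3) u]
            lin_map_compose[OF mods'(2) P(3) v]], simp)
    ultimately show "u = v"
      by (rule pushout_map_eq[OF po mods' Q lin_map_compose[OF A f bl] lin_map_compose[OF A g cl] u v])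
  }
qed

lemma is_pushout_change_tip:
  fixes B C P P' :: "('a, 'm) module"
  assumes po: "is_pushout R A B C f g P j k" and h: "h \<in> lin_iso R P P'" and P': "module R P'"
    and mods: "module R B" "module R C" and f: "f \<in> lin_map R A B" and g: "g \<in> lin_map R A C"
  shows "is_pushout R A B C f g P' (compose (carrier B) h j) (compose (carrier C) h k)"
proof (rule is_pushoutI)
  note P = is_pushoutD[OF po] and hl = lin_isoD(1)[OF h]
  show "module R P'" by fact
  show "compose (carrier B) h j \<in> lin_map R B P'" by (rule lin_map_compose[OF mods(1) P(2) hl])
  show "compose (carrier C) h k \<in> lin_map R C P'" by (rule lin_map_compose[OF mods(2) P(3) hl])
  show "compose (carrier A) (compose (carrier B) h j) f = compose (carrier A) (compose (carrier C) h k) g"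
    using P(4) lin_map_compose_assoc[OF f, of h j] lin_map_compose_assoc[OF g, of h k] by simp
  {
    fix Q :: "('a, 'm) module" and p q
    assume Q: "module R Q" and p: "p \<in> lin_map R B Q" and q: "q \<in> lin_map R C Q"
      and eq: "compose (carrier A) p f = compose (carrier A) q g"
    obtain u where u: "u \<in> lin_map R P Q" "compose (carrier B) u j = p" "compose (carrier C) u k = q"
      using eq by (rule pushout_map_exists[OF po Q p q])
    let ?u = "compose (carrier P') u (lin_inverse P P' h)"
    have u': "?u \<in> lin_map R P' Q"
      by (rule lin_map_compose[OF P' lin_isoD(1)[OF lin_iso_inverse[OF P(1) h]] u(1)])
    have "compose (carrier P) ?u h = u"
      using lin_iso_cancel_right[OF P(1) h u' u(1)] by simp
    then show "\<exists>v \<in> lin_map R P' Q. compose (carrier B) v (compose (carrier B) h j) = p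
        \<and> compose (carrier C) v (compose (carrier C) h k) = q"
      using u u' lin_map_compose_assoc[OF P(2), of ?u h] lin_map_compose_assoc[OF P(3), of ?u h]
      by (intro bexI[of _ ?u] conjI) simp_all
  next
    fix Q :: "('a, 'm) module" and u v
    assume Q: "module R Q" and u: "u \<in> lin_map R P' Q" and v: "v \<in> lin_map R P' Q"
      and eq: "compose (carrier B) u (compose (carrier B) h j) = compose (carrier B) v (compose (carrier B) h j)"
        "compose (carrier C) u (compose (carrier C) h k) = compose (carrier C) v (compose (carrier C) h k)"
    have "compose (carrier P) u h = compose (carrier P) v h"
      using eq lin_map_compose_assoc[OF P(2), of u h] lin_map_compose_assoc[OF P(3), of u h]
        lin_map_compose_assoc[OF P(2), of v h] lin_map_compose_assoc[OF P(3), of v h]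
      by - (rule pushout_map_eq[OF po mods Q f g lin_map_compose[OF P(1) hl u]
            lin_map_compose[OF P(1) hl v]], simp_all)
    then show "u = v"
      by (rule lin_iso_epi[OF P(1) h u v])
  }
qed

lemma pushout_iso:
  fixes B C P P' :: "('a, 'm) module"
  assumes po: "is_pushout R A B C f g P j k" and po': "is_pushout R A B C f g P' j' k'"
    and mods: "module R B" "module R C" and f: "f \<in> lin_map R A B" and g: "g \<in> lin_map R A C"
  shows "\<exists>h \<in> lin_iso R P P'. compose (carrier B) h j = j' \<and> compose (carrier C) h k = k'"
proof -
  note P = is_pushoutD[OF po] and P' = is_pushoutD[OF po']
  obtain u where u: "u \<in> lin_map R P P'" "compose (carrier B) u j = j'" "compose (carrier C) u k = k'"
    by (rule pushout_map_exists[OF po P'])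
  obtain v where v: "v \<in> lin_map R P' P" "compose (carrier B) v j' = j" "compose (carrier C) v k' = k"
    by (rule pushout_map_exists[OF po' P])
  have vu: "compose (carrier P) v u = (\<lambda>x\<in>carrier P. x)"
    using u v lin_map_compose_id(1)[OF P(2)] lin_map_compose_id(1)[OF P(3)]
      lin_map_compose_assoc[OF P(2), of v u] lin_map_compose_assoc[OF P(3), of v u]
    by - (rule pushout_map_eq[OF po mods P(1) f g lin_map_compose[OF P(1) u(1) v(1)] lin_map_id[OF P(1)]], simp_all)
  have uv: "compose (carrier P') u v = (\<lambda>x\<in>carrier P'. x)"
    using u v lin_map_compose_id(1)[OF P'(2)] lin_map_compose_id(1)[OF P'(3)]
      lin_map_compose_assoc[OF P'(2), of u v] lin_map_compose_assoc[OF P'(3), of u v]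
    by - (rule pushout_map_eq[OF po' mods P'(1) f g lin_map_compose[OF P'(1) v(1) u(1)] lin_map_id[OF P'(1)]], simp_all)
  have "bij_betw u (carrier P) (carrier P')"
  proof (rule bij_betwI)
    show "u \<in> carrier P \<rightarrow> carrier P'" by (rule lin_mapD(1)[OF u(1)])
    show "v \<in> carrier P' \<rightarrow> carrier P" by (rule lin_mapD(1)[OF v(1)])
    show "v (u x) = x" if "x \<in> carrier P" for x
      using fun_cong[OF vu, of x] that by (simp add: compose_eq)
    show "u (v y) = y" if "y \<in> carrier P'" for y
      using fun_cong[OF uv, of y] that by (simp add: compose_eq)
  qed
  then have "u \<in> lin_iso R P P'"
    using u(1) unfolding lin_iso_def by simp
  then show ?thesis
    using u(2,3) by (intro bexI[of _ u] conjI)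
qed

section \<open>Cospans up to isomorphism\<close>

lemma is_cospanD:
  assumes "is_cospan R H H' T"
  shows "module R (apex T)" "lleg T \<in> lin_map R H (apex T)" "rleg T \<in> lin_map R H' (apex T)"
  using assms unfolding is_cospan_def by auto

lemma invertible_cospanD:
  assumes "invertible_cospan R H H' T"
  shows "is_cospan R H H' T" "lleg T \<in> lin_iso R H (apex T)" "rleg T \<in> lin_iso R H' (apex T)"
  using assms unfolding invertible_cospan_def by auto

lemma cospan_isomorphic_refl:
  assumes "is_cospan R H H' T"
  shows "cospan_isomorphic R H H' T T"
  unfolding cospan_isomorphic_def
  using is_cospanD[OF assms] lin_map_compose_id(1)[OF is_cospanD(2)[OF assms]]
    lin_map_compose_id(1)[OF is_cospanD(3)[OF assms]]
  by (intro bexI[of _ "\<lambda>x\<in>carrier (apex T). x"] conjI lin_iso_id)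

lemma cospan_isomorphic_sym:
  assumes "is_cospan R H H' T" "cospan_isomorphic R H H' T S"
  shows "cospan_isomorphic R H H' S T"
proof -
  note T = is_cospanD[OF assms(1)]
  obtain f where f: "f \<in> lin_iso R (apex T) (apex S)"
    and S: "compose (carrier H) f (lleg T) = lleg S" "compose (carrier H') f (rleg T) = rleg S"
    using assms(2) unfolding cospan_isomorphic_def by blast
  let ?g = "lin_inverse (apex T) (apex S) f"
  have "compose (carrier H) ?g (lleg S) = lleg T" "compose (carrier H') ?g (rleg S) = rleg T"
    using lin_map_compose_assoc[OF T(2), of ?g f] lin_map_compose_assoc[OF T(3), of ?g f]
      lin_inverse_left[OF f] lin_map_compose_id(1)[OF T(2)] lin_map_compose_id(1)[OF T(3)] S
    by simp_all
  then show ?thesis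
    unfolding cospan_isomorphic_def using lin_iso_inverse[OF T(1) f]
    by (intro bexI[of _ ?g] conjI)
qed

lemma cospan_isomorphic_trans:
  assumes "is_cospan R H H' T" "cospan_isomorphic R H H' T S" "cospan_isomorphic R H H' S S'"
  shows "cospan_isomorphic R H H' T S'"
proof -
  note T = is_cospanD[OF assms(1)]
  obtain f where f: "f \<in> lin_iso R (apex T) (apex S)"
    "compose (carrier H) f (lleg T) = lleg S" "compose (carrier H') f (rleg T) = rleg S"
    using assms(2) unfolding cospan_isomorphic_def by blast
  obtain g where g: "g \<in> lin_iso R (apex S) (apex S')"
    "compose (carrier H) g (lleg S) = lleg S'" "compose (carrier H') g (rleg S) = rleg S'"
    using assms(3) unfolding cospan_isomorphic_def by blast
  have "compose (carrier H) (compose (carrier (apex T)) g f) (lleg T) = lleg S'"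
    "compose (carrier H') (compose (carrier (apex T)) g f) (rleg T) = rleg S'"
    using lin_map_compose_assoc[OF T(2), of g f] lin_map_compose_assoc[OF T(3), of g f] f g
    by simp_all
  then show ?thesis
    unfolding cospan_isomorphic_def using lin_iso_compose[OF T(1) f(1) g(1)]
    by (intro bexI[of _ "compose (carrier (apex T)) g f"] conjI)
qed

lemma mem_cospan_class_self: "is_cospan R H H' T \<Longrightarrow> T \<in> cospan_class R H H' T"
  unfolding cospan_class_def by (simp add: cospan_isomorphic_refl)

lemma cospan_class_eq:
  assumes "is_cospan R H H' T" "is_cospan R H H' S" "cospan_isomorphic R H H' T S"
  shows "cospan_class R H H' T = cospan_class R H H' S"
  unfolding cospan_class_def
  using cospan_isomorphic_trans[OF assms(1,3)] cospan_isomorphic_sym[OF assms(1,3)]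
    cospan_isomorphic_trans[OF assms(2)] by blast

lemma invertible_cospan_isomorphic:
  assumes "module R H" "module R H'" "invertible_cospan R H H' T" "is_cospan R H H' S"
    and "cospan_isomorphic R H H' T S"
  shows "invertible_cospan R H H' S"
proof -
  obtain f where f: "f \<in> lin_iso R (apex T) (apex S)"
    "compose (carrier H) f (lleg T) = lleg S" "compose (carrier H') f (rleg T) = rleg S"
    using assms(5) unfolding cospan_isomorphic_def by blast
  then show ?thesis
    using assms(4) lin_iso_compose[OF assms(1) invertible_cospanD(2)[OF assms(3)] f(1)]
      lin_iso_compose[OF assms(2) invertible_cospanD(3)[OF assms(3)] f(1)]
    unfolding invertible_cospan_def by simp
qed

text \<open>A single pushout of the given representatives determines the composite class.  A member of the
  composite comes from a pushout over other representatives, which is also a pushout over the given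
  ones and so isomorphic to \<open>P\<close>; conversely, an isomorphism from \<open>P\<close> to the apex of a cospan
  makes that apex a pushout.\<close>

lemma comp_cospan_class_eq:
  fixes H H' H'' :: "('a, 'm) herm_module"
  assumes mods: "module R H" "module R H'" "module R H''"
    and T1: "is_cospan R H H' T1" and T2: "is_cospan R H' H'' T2"
    and po: "is_pushout R H' (apex T1) (apex T2) (rleg T1) (lleg T2) P j1 j2"
  shows "comp_cospan_class R H H' H'' (cospan_class R H' H'' T2) (cospan_class R H H' T1)
    = cospan_class R H H''
        \<lparr>apex = P, lleg = compose (carrier H) j1 (lleg T1), rleg = compose (carrier H'') j2 (rleg T2)\<rparr>"
    (is "?comp = cospan_class R H H'' ?T")
proof (intro equalityI subsetI)
  note P = is_pushoutD[OF po] and t1 = is_cospanD[OF T1] and t2 = is_cospanD[OF T2]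
  fix S assume "S \<in> ?comp"
  then obtain P' k1 k2 S1 S2 where S: "S = \<lparr>apex = P', lleg = compose (carrier H) k1 (lleg S1),
        rleg = compose (carrier H'') k2 (rleg S2)\<rparr>"
      and S1: "S1 \<in> cospan_class R H H' T1" and S2: "S2 \<in> cospan_class R H' H'' T2"
      and po': "is_pushout R H' (apex S1) (apex S2) (rleg S1) (lleg S2) P' k1 k2"
    unfolding comp_cospan_class_def by blast
  note P' = is_pushoutD[OF po']
  obtain b where b: "b \<in> lin_iso R (apex T1) (apex S1)" "compose (carrier H) b (lleg T1) = lleg S1"
      "compose (carrier H') b (rleg T1) = rleg S1" and s1: "is_cospan R H H' S1"
    using S1 unfolding cospan_class_def cospan_isomorphic_def by blast
  obtain c where c: "c \<in> lin_iso R (apex T2) (apex S2)" "compose (carrier H') c (lleg T2) = lleg S2"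
      "compose (carrier H'') c (rleg T2) = rleg S2" and s2: "is_cospan R H' H'' S2"
    using S2 unfolding cospan_class_def cospan_isomorphic_def by blast
  have "is_pushout R H' (apex T1) (apex T2) (rleg T1) (lleg T2) P'
      (compose (carrier (apex T1)) k1 b) (compose (carrier (apex T2)) k2 c)"
    using po' b(3) c(2) is_cospanD(1)[OF s1] is_cospanD(1)[OF s2]
    by - (rule is_pushout_change_span[OF _ mods(2) t1(1) t2(1) _ _ b(1) c(1) t1(3) t2(2)], simp_all)
  from pushout_iso[OF po this t1(1) t2(1) t1(3) t2(2)]
  obtain h where h: "h \<in> lin_iso R P P'"
      "compose (carrier (apex T1)) h j1 = compose (carrier (apex T1)) k1 b"
      "compose (carrier (apex T2)) h j2 = compose (carrier (apex T2)) k2 c"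
    by blast
  have "compose (carrier H) h (compose (carrier H) j1 (lleg T1)) = lleg S"
    using lin_map_compose_assoc[OF t1(2), of h j1] lin_map_compose_assoc[OF t1(2), of k1 b] h b S by simp
  moreover have "compose (carrier H'') h (compose (carrier H'') j2 (rleg T2)) = rleg S"
    using lin_map_compose_assoc[OF t2(3), of h j2] lin_map_compose_assoc[OF t2(3), of k2 c] h c S by simp
  moreover have "is_cospan R H H'' S"
    unfolding is_cospan_def S
    using P' lin_map_compose[OF mods(1) is_cospanD(2)[OF s1] P'(2)]
      lin_map_compose[OF mods(3) is_cospanD(3)[OF s2] P'(3)] by simp
  ultimately show "S \<in> cospan_class R H H'' ?T"
    unfolding cospan_class_def cospan_isomorphic_def using h(1) S
    by (intro CollectI conjI bexI[of _ h]) simp_all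
next
  note P = is_pushoutD[OF po] and t1 = is_cospanD[OF T1] and t2 = is_cospanD[OF T2]
  fix S assume "S \<in> cospan_class R H H'' ?T"
  then obtain h where h: "h \<in> lin_iso R P (apex S)" and s: "is_cospan R H H'' S"
      and S: "compose (carrier H) h (compose (carrier H) j1 (lleg T1)) = lleg S"
        "compose (carrier H'') h (compose (carrier H'') j2 (rleg T2)) = rleg S"
    unfolding cospan_class_def cospan_isomorphic_def by auto
  have "is_pushout R H' (apex T1) (apex T2) (rleg T1) (lleg T2) (apex S)
      (compose (carrier (apex T1)) h j1) (compose (carrier (apex T2)) h j2)"
    by (rule is_pushout_change_tip[OF po h is_cospanD(1)[OF s] t1(1) t2(1) t1(3) t2(2)])
  moreover have "S = \<lparr>apex = apex S,
      lleg = compose (carrier H) (compose (carrier (apex T1)) h j1) (lleg T1),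
      rleg = compose (carrier H'') (compose (carrier (apex T2)) h j2) (rleg T2)\<rparr>"
    using S lin_map_compose_assoc[OF t1(2), of h j1] lin_map_compose_assoc[OF t2(3), of h j2] by simp
  ultimately show "S \<in> ?comp"
    unfolding comp_cospan_class_def using mem_cospan_class_self[OF T1] mem_cospan_class_self[OF T2]
    by blast
qed

section \<open>Cospans with an identity leg\<close>

text \<open>The apex is the codomain with its form forgotten, so that \<open>\<phi>\<close> itself is the left leg.\<close>

definition map_cospan ::
  "('a, 'm) herm_module \<Rightarrow> ('m \<Rightarrow> 'm) \<Rightarrow> ('a, 'm) cospan" where
  "map_cospan H' \<phi> = \<lparr>apex = module.truncate H', lleg = \<phi>, rleg = (\<lambda>y\<in>carrier H'. y)\<rparr>"

lemma map_cospan_sel [simp]: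
  "apex (map_cospan H' \<phi>) = module.truncate H'" "lleg (map_cospan H' \<phi>) = \<phi>"
  "rleg (map_cospan H' \<phi>) = (\<lambda>y\<in>carrier H'. y)"
  by (simp_all add: map_cospan_def)

lemma id_cospan_eq_map_cospan: "id_cospan H = map_cospan H (\<lambda>x\<in>carrier H. x)"
  by (simp add: id_cospan_def map_cospan_def)

lemma is_cospan_map_cospan:
  "\<lbrakk>module R H'; \<phi> \<in> lin_map R H H'\<rbrakk> \<Longrightarrow> is_cospan R H H' (map_cospan H' \<phi>)"
  unfolding is_cospan_def by (simp add: module_truncate lin_map_id)

lemma invertible_map_cospan:
  "\<lbrakk>module R H'; \<phi> \<in> lin_iso R H H'\<rbrakk> \<Longrightarrow> invertible_cospan R H H' (map_cospan H' \<phi>)"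
  unfolding invertible_cospan_def
  by (simp add: is_cospan_map_cospan lin_isoD(1) lin_iso_id)

lemma comp_map_cospan:
  fixes H H' H'' :: "('a, 'm) herm_module"
  assumes mods: "module R H" "module R H'" "module R H''"
    and \<phi>: "\<phi> \<in> lin_map R H H'" and \<psi>: "\<psi> \<in> lin_map R H' H''"
  shows "comp_cospan_class R H H' H'' (cospan_class R H' H'' (map_cospan H'' \<psi>))
      (cospan_class R H H' (map_cospan H' \<phi>))
    = cospan_class R H H'' (map_cospan H'' (compose (carrier H) \<psi> \<phi>))"
proof -
  have "is_pushout R H' (module.truncate H') (module.truncate H'') (\<lambda>x\<in>carrier H'. x) \<psi>
      (module.truncate H'') \<psi> (\<lambda>y\<in>carrier (module.truncate H''). y)"
    using \<psi> by (intro pushout_of_identity mods(2) module_truncate[OF mods(3)]) simp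
  then have "is_pushout R H' (apex (map_cospan H' \<phi>)) (apex (map_cospan H'' \<psi>))
      (rleg (map_cospan H' \<phi>)) (lleg (map_cospan H'' \<psi>)) (module.truncate H'') \<psi> (\<lambda>y\<in>carrier H''. y)"
    by simp
  from comp_cospan_class_eq[OF mods is_cospan_map_cospan[OF mods(2) \<phi>] is_cospan_map_cospan[OF mods(3) \<psi>] this]
  show ?thesis
    using lin_map_compose_id(1)[OF lin_map_id[OF mods(3)]] by (simp add: map_cospan_def)
qed

lemma cospan_map_eq:
  assumes "invertible_cospan R H H' T"
  shows "cospan_map H H' T = compose (carrier H) (lin_inverse H' (apex T) (rleg T)) (lleg T)"
  using lin_mapD(3)[OF is_cospanD(2)[OF invertible_cospanD(1)[OF assms]]]
  unfolding cospan_map_def lin_inverse_def by (auto simp: compose_def)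

lemma cospan_map_iso:
  assumes "module R H" "module R H'" "invertible_cospan R H H' T"
  shows "cospan_map H H' T \<in> lin_iso R H H'"
  using lin_iso_compose[OF assms(1) invertible_cospanD(2)[OF assms(3)]
      lin_iso_inverse[OF assms(2) invertible_cospanD(3)[OF assms(3)]]]
  by (simp add: cospan_map_eq[OF assms(3)])

lemma cospan_class_eq_map_cospan:
  fixes H H' :: "('a, 'm) herm_module"
  assumes "module R H" "module R H'" and T: "invertible_cospan R H H' T"
  shows "cospan_class R H H' T = cospan_class R H H' (map_cospan H' (cospan_map H H' T))"
proof (rule cospan_class_eq)
  show "is_cospan R H H' T" by (rule invertible_cospanD(1)[OF T])
  show "is_cospan R H H' (map_cospan H' (cospan_map H H' T))"
    by (rule is_cospan_map_cospan[OF assms(2) lin_isoD(1)[OF cospan_map_iso[OF assms]]])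
  have "lin_inverse H' (apex T) (rleg T) \<in> lin_iso R (apex T) H'"
    by (rule lin_iso_inverse[OF assms(2) invertible_cospanD(3)[OF T]])
  then show "cospan_isomorphic R H H' T (map_cospan H' (cospan_map H H' T))"
    unfolding cospan_isomorphic_def
    using cospan_map_eq[OF T] lin_inverse_left[OF invertible_cospanD(3)[OF T]]
    by (intro bexI[of _ "lin_inverse H' (apex T) (rleg T)"] conjI) simp_all
qed

lemma cospan_rel_invertible:
  assumes T: "invertible_cospan R H H' T"
  shows "cospan_rel H H' T = {(x, cospan_map H H' T x) | x. x \<in> carrier H}"
proof -
  note t = invertible_cospanD[OF T]
  have "y \<in> carrier H' \<and> rleg T y = lleg T x \<longleftrightarrow> y = cospan_map H H' T x"
    if x: "x \<in> carrier H" for x y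
  proof -
    have img: "lleg T x \<in> rleg T ` carrier H'"
      using lin_mapD(3)[OF lin_isoD(1)[OF t(2)] x] lin_isoD(4)[OF t(3)] by simp
    have inv: "inv_into (carrier H') (rleg T) (rleg T y) = y" if "y \<in> carrier H'"
      by (rule inv_into_f_f[OF lin_isoD(3)[OF t(3)] that])
    have "cospan_map H H' T x = inv_into (carrier H') (rleg T) (lleg T x)"
      using x by (simp add: cospan_map_def compose_eq)
    then show ?thesis
      using inv_into_into[OF img] f_inv_into_f[OF img] inv by auto
  qed
  then show ?thesis
    unfolding cospan_rel_def by auto
qed

text \<open>The relation of a cospan is an invariant of its class and, for an invertible cospan, is the
  graph of its map.  Since the map is extensional, its graph determines it.\<close>

lemma cospan_map_class:
  assumes "module R H" "module R H'" "invertible_cospan R H H' T" "S \<in> cospan_class R H H' T"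
  shows "invertible_cospan R H H' S" "cospan_map H H' S = cospan_map H H' T"
proof -
  have S: "is_cospan R H H' S" "cospan_isomorphic R H H' T S"
    using assms(4) unfolding cospan_class_def by auto
  then show inv: "invertible_cospan R H H' S"
    using invertible_cospan_isomorphic assms by blast
  have "{(x, cospan_map H H' S x) | x. x \<in> carrier H} = {(x, cospan_map H H' T x) | x. x \<in> carrier H}"
    using cospan_rel_isomorphic[OF invertible_cospanD(1)[OF assms(3)] S(2)]
      cospan_rel_invertible[OF inv] cospan_rel_invertible[OF assms(3)] by simp
  then have "cospan_map H H' S x = cospan_map H H' T x" if "x \<in> carrier H" for x
    using that by blast
  then show "cospan_map H H' S = cospan_map H H' T"
    by (intro extensionalityI[of _ "carrier H"]) (simp_all add: cospan_map_def)
qed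

lemma cospan_map_map_cospan:
  assumes "\<phi> \<in> lin_map R H H'"
  shows "cospan_map H H' (map_cospan H' \<phi>) = \<phi>"
proof (rule extensionalityI[of _ "carrier H"])
  show "\<phi> \<in> extensional (carrier H)" by (rule lin_mapD(2)[OF assms])
  fix x assume x: "x \<in> carrier H"
  then have "inv_into (carrier H') (\<lambda>y\<in>carrier H'. y) (\<phi> x) = \<phi> x"
    using lin_mapD(3)[OF assms x] by (intro inv_into_f_eq) (auto simp: inj_on_def)
  then show "cospan_map H H' (map_cospan H' \<phi>) x = \<phi> x"
    using x by (simp add: cospan_map_def compose_eq)
qed (simp add: cospan_map_def)

section \<open>Isomorphisms of cospans are invertible\<close>

text \<open>The identity cospan is itself a member of the composite, so the pushout it comes from has
  apex \<open>H\<close> and its structure maps are literal retractions of the outer legs.\<close>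

lemma identity_composite_retractions:
  fixes H H' :: "('a, 'm) herm_module"
  assumes mods: "module R H" "module R H'"
    and T: "is_cospan R H H' T" and T': "is_cospan R H' H T'"
    and "comp_cospan_class R H H' H (cospan_class R H' H T') (cospan_class R H H' T)
      = cospan_class R H H (id_cospan H)"
  obtains j j' where
    "is_pushout R H' (apex T) (apex T') (rleg T) (lleg T') (module.truncate H) j j'"
    "compose (carrier H) j (lleg T) = (\<lambda>x\<in>carrier H. x)"
    "compose (carrier H) j' (rleg T') = (\<lambda>x\<in>carrier H. x)"
proof -
  note t = is_cospanD[OF T] and t' = is_cospanD[OF T']
  have "id_cospan H \<in> comp_cospan_class R H H' H (cospan_class R H' H T') (cospan_class R H H' T)"
    unfolding assms(5) id_cospan_eq_map_cospan
    by (rule mem_cospan_class_self[OF is_cospan_map_cospan[OF mods(1) lin_map_id[OF mods(1)]]])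
  then obtain k k' S S' where S: "S \<in> cospan_class R H H' T" and S': "S' \<in> cospan_class R H' H T'"
      and po: "is_pushout R H' (apex S) (apex S') (rleg S) (lleg S') (module.truncate H) k k'"
      and id: "compose (carrier H) k (lleg S) = (\<lambda>x\<in>carrier H. x)"
        "compose (carrier H) k' (rleg S') = (\<lambda>x\<in>carrier H. x)"
    unfolding comp_cospan_class_def id_cospan_def by auto
  obtain b where b: "b \<in> lin_iso R (apex T) (apex S)" "compose (carrier H) b (lleg T) = lleg S"
      "compose (carrier H') b (rleg T) = rleg S" and s: "is_cospan R H H' S"
    using S unfolding cospan_class_def cospan_isomorphic_def by blast
  obtain c where c: "c \<in> lin_iso R (apex T') (apex S')" "compose (carrier H') c (lleg T') = lleg S'"
      "compose (carrier H) c (rleg T') = rleg S'" and s': "is_cospan R H' H S'"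
    using S' unfolding cospan_class_def cospan_isomorphic_def by blast
  show thesis
  proof (rule that)
    show "is_pushout R H' (apex T) (apex T') (rleg T) (lleg T') (module.truncate H)
        (compose (carrier (apex T)) k b) (compose (carrier (apex T')) k' c)"
      using po b(3) c(2) is_cospanD(1)[OF s] is_cospanD(1)[OF s']
      by - (rule is_pushout_change_span[OF _ mods(2) t(1) t'(1) _ _ b(1) c(1) t(3) t'(2)], simp_all)
    show "compose (carrier H) (compose (carrier (apex T)) k b) (lleg T) = (\<lambda>x\<in>carrier H. x)"
      using id(1) b(2) lin_map_compose_assoc[OF t(2), of k b] by simp
    show "compose (carrier H) (compose (carrier (apex T')) k' c) (rleg T') = (\<lambda>x\<in>carrier H. x)"
      using id(2) c(3) lin_map_compose_assoc[OF t'(3), of k' c] by simp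
  qed
qed

text \<open>Each composite provides retractions of two of the four legs.  The retractions found on one side
  show that the structure maps of the pushout on the other side are injective, and an injective
  retraction of a leg inverts it.\<close>

lemma inverse_classes_imp_invertible:
  fixes H H' :: "('a, 'm) herm_module"
  assumes mods: "module R H" "module R H'"
    and T: "is_cospan R H H' T" and T': "is_cospan R H' H T'"
    and id: "comp_cospan_class R H H' H (cospan_class R H' H T') (cospan_class R H H' T)
      = cospan_class R H H (id_cospan H)"
    and id': "comp_cospan_class R H' H H' (cospan_class R H H' T) (cospan_class R H' H T')
      = cospan_class R H' H' (id_cospan H')"
  shows "invertible_cospan R H H' T"
proof -
  note t = is_cospanD[OF T] and t' = is_cospanD[OF T']
  obtain j j' where po: "is_pushout R H' (apex T) (apex T') (rleg T) (lleg T') (module.truncate H) j j'"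
      and j: "compose (carrier H) j (lleg T) = (\<lambda>x\<in>carrier H. x)"
      and j': "compose (carrier H) j' (rleg T') = (\<lambda>x\<in>carrier H. x)"
    by (rule identity_composite_retractions[OF mods T T' id])
  obtain k' k where po': "is_pushout R H (apex T') (apex T) (rleg T') (lleg T) (module.truncate H') k' k"
      and k': "compose (carrier H') k' (lleg T') = (\<lambda>x\<in>carrier H'. x)"
      and k: "compose (carrier H') k (rleg T) = (\<lambda>x\<in>carrier H'. x)"
    by (rule identity_composite_retractions[OF mods(2,1) T' T id'])
  have jmap: "j \<in> lin_map R (apex T) H" "j' \<in> lin_map R (apex T') H"
    using is_pushoutD(2,3)[OF po] by simp_all
  have kmap: "k \<in> lin_map R (apex T) H'" "k' \<in> lin_map R (apex T') H'"
    using is_pushoutD(2,3)[OF po'] by simp_all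
  have "inj_on j (carrier (apex T))"
    by (rule pushout_of_split_mono[OF po t(1) t'(1) t(3) t'(2) kmap(2) k'])
  then have "lleg T \<in> lin_iso R H (apex T)"
    by (rule retraction_imp_iso[OF t(2) jmap(1) _ j])
  moreover have "inj_on k (carrier (apex T))"
    by (rule pushout_of_split_mono[OF is_pushout_sym[OF po' t'(1) t(1) t'(3) t(2)]
          t(1) t'(1) t(2) t'(3) jmap(2) j'])
  then have "rleg T \<in> lin_iso R H' (apex T)"
    by (rule retraction_imp_iso[OF t(3) kmap(1) _ k])
  ultimately show ?thesis
    using T unfolding invertible_cospan_def by simp
qed

section \<open>Unitary maps and Lagrangian graphs\<close>

lemma hermitian_moduleD:
  assumes "hermitian_module R bar H"
  shows "module R H"
    and "\<lbrakk>x \<in> carrier H; y \<in> carrier H\<rbrakk> \<Longrightarrow> form H x y \<in> carrier R"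
    and "\<lbrakk>a \<in> carrier R; b \<in> carrier R; x \<in> carrier H; y \<in> carrier H; z \<in> carrier H\<rbrakk> \<Longrightarrow>
      form H (a \<odot>\<^bsub>H\<^esub> x \<oplus>\<^bsub>H\<^esub> b \<odot>\<^bsub>H\<^esub> y) z = a \<otimes>\<^bsub>R\<^esub> form H x z \<oplus>\<^bsub>R\<^esub> b \<otimes>\<^bsub>R\<^esub> form H y z"
    and "\<lbrakk>x \<in> carrier H; y \<in> carrier H\<rbrakk> \<Longrightarrow> form H x y = \<ominus>\<^bsub>R\<^esub> bar (form H y x)"
    and "\<lbrakk>x \<in> carrier H; \<And>y. y \<in> carrier H \<Longrightarrow> form H x y = \<zero>\<^bsub>R\<^esub>\<rbrakk> \<Longrightarrow> x = \<zero>\<^bsub>H\<^esub>"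
proof -
  note H = assms[unfolded hermitian_module_def skew_hermitian_form_def]
  show "module R H"
    by (rule H[THEN conjunct1])
  note form = H[THEN conjunct2, THEN conjunct2]
  note skew = form[THEN conjunct2, THEN conjunct2]
  show "form H x y \<in> carrier R" if "x \<in> carrier H" "y \<in> carrier H"
    by (rule form[THEN conjunct1, rule_format, OF that])
  show "form H (a \<odot>\<^bsub>H\<^esub> x \<oplus>\<^bsub>H\<^esub> b \<odot>\<^bsub>H\<^esub> y) z = a \<otimes>\<^bsub>R\<^esub> form H x z \<oplus>\<^bsub>R\<^esub> b \<otimes>\<^bsub>R\<^esub> form H y z"
    if "a \<in> carrier R" "b \<in> carrier R" "x \<in> carrier H" "y \<in> carrier H" "z \<in> carrier H"
    by (rule form[THEN conjunct2, THEN conjunct1, rule_format, OF that])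
  show "form H x y = \<ominus>\<^bsub>R\<^esub> bar (form H y x)" if "x \<in> carrier H" "y \<in> carrier H"
    by (rule skew[THEN conjunct1, rule_format, OF that])
  show "x = \<zero>\<^bsub>H\<^esub>" if "x \<in> carrier H" "\<And>y. y \<in> carrier H \<Longrightarrow> form H x y = \<zero>\<^bsub>R\<^esub>"
    by (rule skew[THEN conjunct2, rule_format, OF that])
qed

lemma hermitian_eqI:
  assumes H: "hermitian_module R bar H" and x: "x \<in> carrier H" and y: "y \<in> carrier H"
    and eq: "\<And>z. z \<in> carrier H \<Longrightarrow> form H x z = form H y z"
  shows "x = y"
proof -
  interpret module R H by (rule hermitian_moduleD(1)[OF H])
  have diff: "x \<ominus>\<^bsub>H\<^esub> y = \<one>\<^bsub>R\<^esub> \<odot>\<^bsub>H\<^esub> x \<oplus>\<^bsub>H\<^esub> (\<ominus>\<^bsub>R\<^esub> \<one>\<^bsub>R\<^esub>) \<odot>\<^bsub>H\<^esub> y"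
    using x y by (simp add: smult_l_minus M.minus_eq)
  have "form H (x \<ominus>\<^bsub>H\<^esub> y) z = \<zero>\<^bsub>R\<^esub>" if z: "z \<in> carrier H" for z
    unfolding diff
    using hermitian_moduleD(3)[OF H _ _ x y z, of "\<one>\<^bsub>R\<^esub>" "\<ominus>\<^bsub>R\<^esub> \<one>\<^bsub>R\<^esub>"] eq[OF z]
      hermitian_moduleD(2)[OF H y z] by (simp add: R.l_minus R.r_neg)
  then have "x \<ominus>\<^bsub>H\<^esub> y = \<zero>\<^bsub>H\<^esub>"
    using hermitian_moduleD(5)[OF H] x y M.minus_closed by blast
  then show ?thesis
    using x y M.minus_equality[of x "\<ominus>\<^bsub>H\<^esub> y"] by (simp add: M.minus_eq)
qed

lemma hermitian_eqI_right:
  assumes H: "hermitian_module R bar H" and x: "x \<in> carrier H" and y: "y \<in> carrier H"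
    and eq: "\<And>z. z \<in> carrier H \<Longrightarrow> form H z x = form H z y"
  shows "x = y"
proof (rule hermitian_eqI[OF H x y])
  show "form H x z = form H y z" if "z \<in> carrier H" for z
    using hermitian_moduleD(4)[OF H x that] hermitian_moduleD(4)[OF H y that] eq[OF that] by simp
qed

text \<open>Non-degeneracy reduces torsion-freeness of \<open>H\<close> to cancellation in \<open>R\<close>.\<close>

lemma hermitian_smult_cancel:
  assumes "domain R" and H: "hermitian_module R bar H" and x: "x \<in> carrier H" and y: "y \<in> carrier H"
    and a: "a \<in> carrier R" "a \<noteq> \<zero>\<^bsub>R\<^esub>" and eq: "a \<odot>\<^bsub>H\<^esub> x = a \<odot>\<^bsub>H\<^esub> y"
  shows "x = y"
proof (rule hermitian_eqI[OF H x y])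
  interpret R: domain R by fact
  interpret module R H by (rule hermitian_moduleD(1)[OF H])
  fix z assume z: "z \<in> carrier H"
  have smult: "form H (a \<odot>\<^bsub>H\<^esub> w) z = a \<otimes>\<^bsub>R\<^esub> form H w z" if w: "w \<in> carrier H" for w
    using hermitian_moduleD(3)[OF H a(1) R.zero_closed w w z] hermitian_moduleD(2)[OF H w z] a(1) w
    by simp
  have "a \<otimes>\<^bsub>R\<^esub> form H x z = a \<otimes>\<^bsub>R\<^esub> form H y z"
    using smult[OF x] smult[OF y] eq by simp
  then show "form H x z = form H y z"
    using a hermitian_moduleD(2)[OF H x z] hermitian_moduleD(2)[OF H y z] by (simp add: R.m_lcancel)
qed

lemma herm_sum_simps [simp]:
  "carrier (herm_sum R H K) = carrier H \<times> carrier K"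
  "zero (herm_sum R H K) = (\<zero>\<^bsub>H\<^esub>, \<zero>\<^bsub>K\<^esub>)"
  "(x, y) \<oplus>\<^bsub>herm_sum R H K\<^esub> (x', y') = (x \<oplus>\<^bsub>H\<^esub> x', y \<oplus>\<^bsub>K\<^esub> y')"
  "a \<odot>\<^bsub>herm_sum R H K\<^esub> (x, y) = (a \<odot>\<^bsub>H\<^esub> x, a \<odot>\<^bsub>K\<^esub> y)"
  "form (herm_sum R H K) (x, y) (x', y') = form H x x' \<oplus>\<^bsub>R\<^esub> form K y y'"
  by (simp_all add: herm_sum_def)

lemma herm_neg_simps [simp]:
  "carrier (herm_neg R H) = carrier H" "zero (herm_neg R H) = zero H"
  "add (herm_neg R H) = add H" "smult (herm_neg R H) = smult H"
  "form (herm_neg R H) x y = \<ominus>\<^bsub>R\<^esub> form H x y"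
  by (simp_all add: herm_neg_def)

lemma module_herm_sum:
  assumes "module R H" "module R K"
  shows "module R (herm_sum R H K)"
proof -
  interpret H: module R H by fact
  interpret K: module R K by fact
  show ?thesis
  proof (rule moduleI[OF H.is_cring])
    show "abelian_group (herm_sum R H K)"
    proof (rule abelian_groupI)
      fix p assume "p \<in> carrier (herm_sum R H K)"
      then obtain x y where p: "p = (x, y)" "x \<in> carrier H" "y \<in> carrier K"
        by auto
      then show "\<exists>q\<in>carrier (herm_sum R H K). q \<oplus>\<^bsub>herm_sum R H K\<^esub> p = \<zero>\<^bsub>herm_sum R H K\<^esub>"
        by (intro bexI[of _ "(\<ominus>\<^bsub>H\<^esub> x, \<ominus>\<^bsub>K\<^esub> y)"]) (simp_all add: H.M.l_neg K.M.l_neg)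
    next
      fix p q assume "p \<in> carrier (herm_sum R H K)" "q \<in> carrier (herm_sum R H K)"
      then show "p \<oplus>\<^bsub>herm_sum R H K\<^esub> q = q \<oplus>\<^bsub>herm_sum R H K\<^esub> p"
        by (cases p; cases q) (simp add: H.M.a_comm K.M.a_comm)
    qed (auto simp: H.M.a_assoc K.M.a_assoc)
  qed (auto simp: H.smult_l_distr K.smult_l_distr H.smult_r_distr K.smult_r_distr
      H.smult_assoc1 K.smult_assoc1)
qed

text \<open>Inverses and zero of the direct sum are treated as multiples by \<open>-1\<close> and \<open>0\<close>, because additive
  inverses in a module are described only implicitly while scalars act componentwise by definition.\<close>

lemma submodule_graph:
  assumes "module R H" "module R H'" "\<phi> \<in> lin_map R H H'"
  shows "submodule {(x, \<phi> x) | x. x \<in> carrier H} R (herm_sum R (herm_neg R H) H')"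
    (is "submodule ?G R ?M")
proof -
  have "module R (herm_neg R H)"
    by (rule module_cong[OF assms(1)]) simp_all
  from module_herm_sum[OF this assms(2)] interpret module R ?M .
  interpret H: module R H by (rule assms(1))
  note \<phi> = lin_mapD(3-5)[OF assms(3)]
  have smult: "a \<odot>\<^bsub>?M\<^esub> p \<in> ?G" if a: "a \<in> carrier R" and p: "p \<in> ?G" for a p
  proof -
    obtain x where x: "p = (x, \<phi> x)" "x \<in> carrier H"
      using p by blast
    then have "a \<odot>\<^bsub>?M\<^esub> p = (a \<odot>\<^bsub>H\<^esub> x, \<phi> (a \<odot>\<^bsub>H\<^esub> x))"
      using \<phi>(3)[OF a x(2)] by simp
    then show ?thesis
      using H.smult_closed[OF a x(2)] by blast
  qed
  show ?thesis
  proof (rule submoduleI)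
    show sub: "?G \<subseteq> carrier ?M"
      using \<phi>(1) by auto
    show "\<ominus>\<^bsub>?M\<^esub> p \<in> ?G" if p: "p \<in> ?G" for p
    proof -
      have pc: "p \<in> carrier ?M"
        using sub p by (rule subsetD)
      have "(\<ominus>\<^bsub>R\<^esub> \<one>\<^bsub>R\<^esub>) \<odot>\<^bsub>?M\<^esub> p = \<ominus>\<^bsub>?M\<^esub> p"
        using smult_l_minus[OF R.one_closed pc] smult_one[OF pc] by metis
      then show ?thesis
        using smult[OF R.a_inv_closed[OF R.one_closed] p] by metis
    qed
    have z: "(\<zero>\<^bsub>H\<^esub>, \<phi> \<zero>\<^bsub>H\<^esub>) \<in> ?G"
      using H.M.zero_closed by blast
    show "\<zero>\<^bsub>?M\<^esub> \<in> ?G"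
      using smult[OF R.zero_closed z] smult_l_null[OF subsetD[OF sub z]] by metis
    show "p \<oplus>\<^bsub>?M\<^esub> q \<in> ?G" if p: "p \<in> ?G" and q: "q \<in> ?G" for p q
    proof -
      obtain x y where x: "p = (x, \<phi> x)" "x \<in> carrier H" and y: "q = (y, \<phi> y)" "y \<in> carrier H"
        using p q by blast
      then have "p \<oplus>\<^bsub>?M\<^esub> q = (x \<oplus>\<^bsub>H\<^esub> y, \<phi> (x \<oplus>\<^bsub>H\<^esub> y))"
        using \<phi>(2)[OF x(2) y(2)] by simp
      then show ?thesis
        using H.M.a_closed[OF x(2) y(2)] by blast
    qed
  qed (rule smult)
qed

text \<open>If \<open>a y = \<phi> (a x) = a \<phi> x\<close> with \<open>a \<noteq> 0\<close>, then \<open>y = \<phi> x\<close> because \<open>H'\<close> is torsion-free.\<close>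

lemma torsion_closure_graph:
  assumes "domain R" and H: "hermitian_module R bar H" and H': "hermitian_module R bar H'"
    and \<phi>: "\<phi> \<in> lin_map R H H'"
  shows "torsion_closure R (herm_sum R (herm_neg R H) H') {(x, \<phi> x) | x. x \<in> carrier H}
    = {(x, \<phi> x) | x. x \<in> carrier H}"
proof -
  interpret R: domain R by fact
  interpret H: module R H by (rule hermitian_moduleD(1)[OF H])
  interpret H': module R H' by (rule hermitian_moduleD(1)[OF H'])
  note \<phi>c = lin_mapD(3)[OF \<phi>]
  have only: "y = \<phi> x"
    if "x \<in> carrier H" "y \<in> carrier H'" "a \<in> carrier R" "a \<noteq> \<zero>\<^bsub>R\<^esub>" "a \<odot>\<^bsub>H'\<^esub> y = \<phi> (a \<odot>\<^bsub>H\<^esub> x)" for a x y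
    by (rule hermitian_smult_cancel[OF assms(1) H' that(2) \<phi>c[OF that(1)] that(3,4)])
      (rule trans[OF that(5) lin_mapD(5)[OF \<phi> that(3,1)]])
  show ?thesis (is "torsion_closure R ?M ?G = ?G")
  proof (intro equalityI subsetI)
    fix p assume "p \<in> torsion_closure R ?M ?G"
    then obtain a where p: "p \<in> carrier ?M" and a: "a \<in> carrier R" "a \<noteq> \<zero>\<^bsub>R\<^esub>" "a \<odot>\<^bsub>?M\<^esub> p \<in> ?G"
      unfolding torsion_closure_def by blast
    obtain x y where xy: "p = (x, y)" "x \<in> carrier H" "y \<in> carrier H'"
      using p by auto
    then have "a \<odot>\<^bsub>H'\<^esub> y = \<phi> (a \<odot>\<^bsub>H\<^esub> x)"
      using a(3) by simp
    then show "p \<in> ?G"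
      using only[OF xy(2,3) a(1,2)] xy by blast
  next
    fix p assume "p \<in> ?G"
    then obtain x where x: "p = (x, \<phi> x)" "x \<in> carrier H"
      by blast
    have "\<one>\<^bsub>R\<^esub> \<odot>\<^bsub>?M\<^esub> p = p"
      using x \<phi>c[OF x(2)] by simp
    then have "\<one>\<^bsub>R\<^esub> \<odot>\<^bsub>?M\<^esub> p \<in> ?G"
      using x by auto
    moreover have "p \<in> carrier ?M"
      using x \<phi>c[OF x(2)] by simp
    ultimately show "p \<in> torsion_closure R ?M ?G"
      unfolding torsion_closure_def using R.one_closed R.one_not_zero by blast
  qed
qed

lemma mem_U_Hom:
  "\<phi> \<in> Hom (U_cat R bar) H H' \<longleftrightarrow> \<phi> \<in> lin_iso R H H'
    \<and> (\<forall>x \<in> carrier H. \<forall>y \<in> carrier H. form H' (\<phi> x) (\<phi> y) = form H x y)"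
  by (simp add: U_cat_def)

text \<open>A pair \<open>(x, y)\<close> annihilates the graph exactly if \<open>\<omega>' (\<phi> v) y = \<omega> v x\<close> for all \<open>v\<close>.  For
  \<open>y = \<phi> x\<close> this is unitarity.  If \<open>\<phi>\<close> is unitary, the right side is \<open>\<omega>' (\<phi> v) (\<phi> x)\<close>, and
  \<open>\<phi> v\<close> ranges over all of \<open>H'\<close>, so that \<open>y = \<phi> x\<close> by non-degeneracy.\<close>

lemma lagrangian_graph_iff_unitary:
  assumes H: "hermitian_module R bar H" and H': "hermitian_module R bar H'"
    and \<phi>: "\<phi> \<in> lin_iso R H H'"
  shows "lagrangian R (herm_sum R (herm_neg R H) H') {(x, \<phi> x) | x. x \<in> carrier H}
    \<longleftrightarrow> \<phi> \<in> Hom (U_cat R bar) H H'"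
    (is "lagrangian R ?M ?G \<longleftrightarrow> _")
proof -
  interpret H: module R H by (rule hermitian_moduleD(1)[OF H])
  interpret H': module R H' by (rule hermitian_moduleD(1)[OF H'])
  note \<phi>c = lin_mapD(3)[OF lin_isoD(1)[OF \<phi>]]
  have orth: "\<ominus>\<^bsub>R\<^esub> form H v x \<oplus>\<^bsub>R\<^esub> form H' (\<phi> v) y = \<zero>\<^bsub>R\<^esub> \<longleftrightarrow> form H' (\<phi> v) y = form H v x"
    if "v \<in> carrier H" "x \<in> carrier H" "y \<in> carrier H'" for v x y
    using that hermitian_moduleD(2)[OF H] hermitian_moduleD(2)[OF H'] \<phi>c
    by (metis H.R.add.inv_closed H.R.l_neg H.R.minus_equality H.R.minus_minus H.R.add.m_comm)
  have ann: "annihilator R ?M ?G =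
      {(x, y). x \<in> carrier H \<and> y \<in> carrier H' \<and> (\<forall>v \<in> carrier H. form H' (\<phi> v) y = form H v x)}"
    unfolding annihilator_def using orth by auto
  show ?thesis
  proof
    assume "lagrangian R ?M ?G"
    then have "?G = annihilator R ?M ?G"
      unfolding lagrangian_def by blast
    then have "(x, \<phi> x) \<in> annihilator R ?M ?G" if "x \<in> carrier H" for x
      using that by blast
    then show "\<phi> \<in> Hom (U_cat R bar) H H'"
      unfolding ann mem_U_Hom using \<phi> by simp
  next
    assume u: "\<phi> \<in> Hom (U_cat R bar) H H'"
    have "y = \<phi> x" if x: "x \<in> carrier H" and y: "y \<in> carrier H'"
        and eq: "\<And>v. v \<in> carrier H \<Longrightarrow> form H' (\<phi> v) y = form H v x" for x y
    proof (rule hermitian_eqI_right[OF H' y \<phi>c[OF x]])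
      fix w assume "w \<in> carrier H'"
      then obtain v where "v \<in> carrier H" "w = \<phi> v"
        using lin_isoD(4)[OF \<phi>] by blast
      then show "form H' w y = form H' w (\<phi> x)"
        using eq u x unfolding mem_U_Hom by simp
    qed
    then have "annihilator R ?M ?G = ?G"
      unfolding ann using u \<phi>c unfolding mem_U_Hom by blast
    then show "lagrangian R ?M ?G"
      unfolding lagrangian_def
      using submodule_graph[OF hermitian_moduleD(1)[OF H] hermitian_moduleD(1)[OF H'] lin_isoD(1)[OF \<phi>]]
      by simp
  qed
qed

lemma lagrangian_invertible_cospan_iff:
  assumes "domain R" and H: "hermitian_module R bar H" and H': "hermitian_module R bar H'"
    and T: "invertible_cospan R H H' T"
  shows "lagrangian_cospan R bar H H' T \<longleftrightarrow> cospan_map H H' T \<in> Hom (U_cat R bar) H H'"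
proof -
  have iso: "cospan_map H H' T \<in> lin_iso R H H'"
    by (rule cospan_map_iso[OF hermitian_moduleD(1)[OF H] hermitian_moduleD(1)[OF H'] T])
  show ?thesis
    unfolding lagrangian_cospan_def cospan_rel_closure_def cospan_rel_invertible[OF T]
      torsion_closure_graph[OF assms(1) H H' lin_isoD(1)[OF iso]]
      lagrangian_graph_iff_unitary[OF H H' iso]
    using H H' invertible_cospanD(1)[OF T] by simp
qed

section \<open>Transport of a category along bijections of hom-sets\<close>

lemma cat_iso_Ident:
  assumes "category C" "x \<in> Obj C"
  shows "cat_iso C x x (Ident C x)"
  unfolding cat_iso_def
  using category.Ident_in_Hom[OF assms]
    category.Comp_Ident_left[OF assms(1,2,2) category.Ident_in_Hom[OF assms]] by blast

text \<open>If each hom-set of \<open>C\<close> is the image of the hom-set of \<open>D\<close> under a map \<open>G\<close> which respects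
  composition and identities and has \<open>F\<close> as a left inverse, then \<open>C\<close> inherits the category axioms
  from \<open>D\<close>, and \<open>F\<close> and \<open>G\<close> are strictly inverse functors.  For the core of \<open>\<^bold>L\<close> this proves at
  the same time that it is a category.\<close>

lemma equivalence_by_transport:
  fixes C :: "('o, 'm) cat" and D :: "('o, 'n) cat"
  assumes D: "category D" and Obj: "Obj C = Obj D"
    and Hom: "\<And>x y. \<lbrakk>x \<in> Obj D; y \<in> Obj D\<rbrakk> \<Longrightarrow> Hom C x y = G x y ` Hom D x y"
    and Comp: "\<And>x y z f g. \<lbrakk>x \<in> Obj D; y \<in> Obj D; z \<in> Obj D; f \<in> Hom D x y; g \<in> Hom D y z\<rbrakk>
      \<Longrightarrow> Comp C x y z (G y z g) (G x y f) = G x z (Comp D x y z g f)"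
    and Ident: "\<And>x. x \<in> Obj D \<Longrightarrow> Ident C x = G x x (Ident D x)"
    and F_obj: "\<And>x. on_obj F x = x"
    and F_arr: "\<And>x y f. \<lbrakk>x \<in> Obj D; y \<in> Obj D; f \<in> Hom D x y\<rbrakk> \<Longrightarrow> on_arr F x y (G x y f) = f"
  shows "is_equivalence C D F"
proof -
  interpret D: category D by fact
  have C: "category C"
  proof
    fix w x y z f g h
    assume "w \<in> Obj C" "x \<in> Obj C" "y \<in> Obj C" "z \<in> Obj C" "f \<in> Hom C w x" "g \<in> Hom C x y" "h \<in> Hom C y z"
    then show "Comp C w y z h (Comp C w x y g f) = Comp C w x z (Comp C x y z h g) f"
      by (auto simp: Obj Hom Comp D.Comp_in_Hom D.Comp_assoc)
  qed (auto simp: Obj Hom Comp Ident D.Ident_in_Hom D.Comp_in_Hom D.Comp_Ident_left D.Comp_Ident_right)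
  have F: "is_functor C D F"
    unfolding is_functor_def using C D
    by (auto simp: Obj Hom Comp Ident F_obj F_arr D.Ident_in_Hom D.Comp_in_Hom)
  define G' where "G' = \<lparr>on_obj = (\<lambda>x. x), on_arr = G\<rparr>"
  have G': "is_functor D C G'"
    unfolding is_functor_def G'_def using C D by (auto simp: Obj Hom Comp Ident)
  have C_iso: "cat_iso C x x (G x x (Ident D x))" if "x \<in> Obj D" for x
    using cat_iso_Ident[OF C, of x] that by (simp add: Obj Ident)
  have "naturally_isomorphic C C (comp_functor G' F) id_functor"
    unfolding naturally_isomorphic_def comp_functor_def id_functor_def G'_def
    by (rule exI[of _ "Ident C"])
      (auto simp: F_obj C_iso Obj Hom F_arr Comp Ident D.Ident_in_Hom
        D.Comp_Ident_left D.Comp_Ident_right)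
  moreover have "naturally_isomorphic D D (comp_functor F G') id_functor"
    unfolding naturally_isomorphic_def comp_functor_def id_functor_def G'_def
    by (rule exI[of _ "Ident D"])
      (auto simp: F_obj cat_iso_Ident[OF D] F_arr D.Comp_Ident_left D.Comp_Ident_right)
  ultimately show ?thesis
    unfolding is_equivalence_def using F G' by blast
qed

section \<open>The core of the category of Lagrangian cospans\<close>

lemma U_Hom_inverse:
  assumes "hermitian_module R bar H" "\<phi> \<in> Hom (U_cat R bar) H H'"
  shows "lin_inverse H H' \<phi> \<in> Hom (U_cat R bar) H' H"
proof -
  have iso: "\<phi> \<in> lin_iso R H H'"
    using assms(2) by (simp add: mem_U_Hom)
  note inv = lin_iso_inverse[OF hermitian_moduleD(1)[OF assms(1)] iso]
  have "\<phi> (lin_inverse H H' \<phi> y) = y" if "y \<in> carrier H'" for y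
    using fun_cong[OF lin_inverse_right[OF iso], of y] that by (simp add: compose_eq)
  then have "form H (lin_inverse H H' \<phi> x) (lin_inverse H H' \<phi> y) = form H' x y"
    if "x \<in> carrier H'" "y \<in> carrier H'" for x y
    using assms(2) lin_mapD(3)[OF lin_isoD(1)[OF inv]] that unfolding mem_U_Hom by metis
  then show ?thesis
    using inv by (simp add: mem_U_Hom)
qed

lemma category_U: "category (U_cat R bar :: (('a, 'm) herm_module, 'm \<Rightarrow> 'm) cat)"
proof
  fix H :: "('a, 'm) herm_module"
  assume "H \<in> Obj (U_cat R bar)"
  then show "Ident (U_cat R bar) H \<in> Hom (U_cat R bar) H H"
    unfolding mem_U_Hom using hermitian_moduleD(1) by (auto simp: U_cat_def intro: lin_iso_id)
next
  fix H H' H'' :: "('a, 'm) herm_module" and \<phi> \<psi>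
  assume H: "H \<in> Obj (U_cat R bar)"
    and \<phi>: "\<phi> \<in> Hom (U_cat R bar) H H'" and \<psi>: "\<psi> \<in> Hom (U_cat R bar) H' H''"
  have iso: "\<phi> \<in> lin_iso R H H'" "\<psi> \<in> lin_iso R H' H''"
    using \<phi> \<psi> by (simp_all add: mem_U_Hom)
  have "module R H"
    using H hermitian_moduleD(1) by (auto simp: U_cat_def)
  then have "compose (carrier H) \<psi> \<phi> \<in> lin_iso R H H''"
    by (rule lin_iso_compose[OF _ iso])
  then show "Comp (U_cat R bar) H H' H'' \<psi> \<phi> \<in> Hom (U_cat R bar) H H''"
    using \<phi> \<psi> lin_mapD(3)[OF lin_isoD(1)[OF iso(1)]] unfolding mem_U_Hom
    by (simp add: U_cat_def compose_eq)
next
  fix H H' :: "('a, 'm) herm_module" and \<phi>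
  assume "\<phi> \<in> Hom (U_cat R bar) H H'"
  then have "\<phi> \<in> lin_map R H H'"
    by (simp add: mem_U_Hom lin_isoD(1))
  from lin_map_compose_id[OF this]
  show "Comp (U_cat R bar) H H H' \<phi> (Ident (U_cat R bar) H) = \<phi>"
    and "Comp (U_cat R bar) H H' H' (Ident (U_cat R bar) H') \<phi> = \<phi>"
    by (simp_all add: U_cat_def)
next
  fix H0 H1 H2 H3 :: "('a, 'm) herm_module" and \<phi> \<psi> \<chi>
  assume "\<phi> \<in> Hom (U_cat R bar) H0 H1"
  then have "\<phi> \<in> lin_map R H0 H1"
    by (simp add: mem_U_Hom lin_isoD(1))
  from lin_map_compose_assoc[OF this, of \<chi> \<psi>]
  show "Comp (U_cat R bar) H0 H2 H3 \<chi> (Comp (U_cat R bar) H0 H1 H2 \<psi> \<phi>) =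
      Comp (U_cat R bar) H0 H1 H3 (Comp (U_cat R bar) H1 H2 H3 \<chi> \<psi>) \<phi>"
    by (simp add: U_cat_def)
qed

lemma lagrangian_map_cospan:
  assumes "domain R" "hermitian_module R bar H" "hermitian_module R bar H'"
    and "\<phi> \<in> Hom (U_cat R bar) H H'"
  shows "lagrangian_cospan R bar H H' (map_cospan H' \<phi>)"
    and "invertible_cospan R H H' (map_cospan H' \<phi>)"
proof -
  have iso: "\<phi> \<in> lin_iso R H H'"
    using assms(4) by (simp add: mem_U_Hom)
  show inv: "invertible_cospan R H H' (map_cospan H' \<phi>)"
    by (rule invertible_map_cospan[OF hermitian_moduleD(1)[OF assms(3)] iso])
  show "lagrangian_cospan R bar H H' (map_cospan H' \<phi>)"
    using lagrangian_invertible_cospan_iff[OF assms(1-3) inv] assms(4)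
      cospan_map_map_cospan[OF lin_isoD(1)[OF iso]] by simp
qed

lemma lagrangian_invertible_classes:
  fixes H H' :: "('a, 'm) herm_module"
  assumes "domain R" "hermitian_module R bar H" "hermitian_module R bar H'"
  shows "{cospan_class R H H' T | T. lagrangian_cospan R bar H H' T \<and> invertible_cospan R H H' T}
    = (\<lambda>\<phi>. cospan_class R H H' (map_cospan H' \<phi>)) ` Hom (U_cat R bar) H H'"
proof (intro equalityI subsetI)
  fix c assume "c \<in> {cospan_class R H H' T | T. lagrangian_cospan R bar H H' T \<and> invertible_cospan R H H' T}"
  then obtain T where T: "c = cospan_class R H H' T" "lagrangian_cospan R bar H H' T"
      and inv: "invertible_cospan R H H' T"
    by blast
  have "cospan_map H H' T \<in> Hom (U_cat R bar) H H'"
    using lagrangian_invertible_cospan_iff[OF assms inv] T(2) by simp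
  then show "c \<in> (\<lambda>\<phi>. cospan_class R H H' (map_cospan H' \<phi>)) ` Hom (U_cat R bar) H H'"
    using T(1) cospan_class_eq_map_cospan[OF assms(2,3)[THEN hermitian_moduleD(1)] inv] by blast
next
  fix c assume "c \<in> (\<lambda>\<phi>. cospan_class R H H' (map_cospan H' \<phi>)) ` Hom (U_cat R bar) H H'"
  then show "c \<in> {cospan_class R H H' T | T. lagrangian_cospan R bar H H' T \<and> invertible_cospan R H H' T}"
    using lagrangian_map_cospan[OF assms] by blast
qed

lemma comp_map_cospan_unitary:
  fixes H H' H'' :: "('a, 'm) herm_module"
  assumes "hermitian_module R bar H" "hermitian_module R bar H'" "hermitian_module R bar H''"
    and "\<phi> \<in> Hom (U_cat R bar) H H'" "\<psi> \<in> Hom (U_cat R bar) H' H''"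
  shows "comp_cospan_class R H H' H'' (cospan_class R H' H'' (map_cospan H'' \<psi>))
      (cospan_class R H H' (map_cospan H' \<phi>))
    = cospan_class R H H'' (map_cospan H'' (compose (carrier H) \<psi> \<phi>))"
  using comp_map_cospan[OF assms(1-3)[THEN hermitian_moduleD(1)]] assms(4,5)
  by (simp add: mem_U_Hom lin_isoD(1))

text \<open>One inclusion is \<open>inverse_classes_imp_invertible\<close>; for the other, the cospan of the inverse
  unitary map is an inverse.\<close>

lemma cat_iso_L_cat:
  fixes H H' :: "('a, 'm) herm_module"
  assumes dom: "domain R" and H: "hermitian_module R bar H" and H': "hermitian_module R bar H'"
  shows "{c. cat_iso (L_cat R bar) H H' c}
    = (\<lambda>\<phi>. cospan_class R H H' (map_cospan H' \<phi>)) ` Hom (U_cat R bar) H H'"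
proof (intro equalityI subsetI)
  note mods = hermitian_moduleD(1)[OF H] hermitian_moduleD(1)[OF H']
  fix c assume "c \<in> {c. cat_iso (L_cat R bar) H H' c}"
  then obtain T T' where T: "c = cospan_class R H H' T" "lagrangian_cospan R bar H H' T"
      and T': "lagrangian_cospan R bar H' H T'"
      and id: "comp_cospan_class R H H' H (cospan_class R H' H T') (cospan_class R H H' T)
        = cospan_class R H H (id_cospan H)"
        "comp_cospan_class R H' H H' (cospan_class R H H' T) (cospan_class R H' H T')
        = cospan_class R H' H' (id_cospan H')"
    unfolding cat_iso_def L_cat_def by auto
  have "invertible_cospan R H H' T"
    using T(2) T' by (intro inverse_classes_imp_invertible[OF mods _ _ id])
      (simp_all add: lagrangian_cospan_def)
  then show "c \<in> (\<lambda>\<phi>. cospan_class R H H' (map_cospan H' \<phi>)) ` Hom (U_cat R bar) H H'"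
    unfolding lagrangian_invertible_classes[OF dom H H', symmetric] using T by blast
next
  fix c assume "c \<in> (\<lambda>\<phi>. cospan_class R H H' (map_cospan H' \<phi>)) ` Hom (U_cat R bar) H H'"
  then obtain \<phi> where \<phi>: "\<phi> \<in> Hom (U_cat R bar) H H'" and c: "c = cospan_class R H H' (map_cospan H' \<phi>)"
    by blast
  let ?\<psi> = "lin_inverse H H' \<phi>"
  have iso: "\<phi> \<in> lin_iso R H H'"
    using \<phi> by (simp add: mem_U_Hom)
  have \<psi>: "?\<psi> \<in> Hom (U_cat R bar) H' H"
    by (rule U_Hom_inverse[OF H \<phi>])
  let ?d = "cospan_class R H' H (map_cospan H ?\<psi>)"
  have "c \<in> Hom (L_cat R bar) H H'" "?d \<in> Hom (L_cat R bar) H' H"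
    using lagrangian_map_cospan(1)[OF dom H H' \<phi>] lagrangian_map_cospan(1)[OF dom H' H \<psi>] c
    by (auto simp: L_cat_def)
  moreover have "Comp (L_cat R bar) H H' H ?d c = Ident (L_cat R bar) H"
    using comp_map_cospan_unitary[OF H H' H \<phi> \<psi>] c
    by (simp add: L_cat_def lin_inverse_left[OF iso] id_cospan_eq_map_cospan)
  moreover have "Comp (L_cat R bar) H' H H' c ?d = Ident (L_cat R bar) H'"
    using comp_map_cospan_unitary[OF H' H H' \<psi> \<phi>] c
    by (simp add: L_cat_def lin_inverse_right[OF iso] id_cospan_eq_map_cospan)
  ultimately show "c \<in> {c. cat_iso (L_cat R bar) H H' c}"
    unfolding cat_iso_def by blast
qed

text \<open>The functor evaluates an arbitrary representative of the class, which \<open>cospan_map_class\<close> shows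
  to be immaterial.\<close>

lemma core_functor_cospan_class:
  fixes H H' :: "('a, 'm) herm_module"
  assumes "module R H" "module R H'" "invertible_cospan R H H' T"
  shows "on_arr core_functor H H' (cospan_class R H H' T) = cospan_map H H' T"
  unfolding core_functor_def
  using cospan_map_class(2)[OF assms someI[of "\<lambda>S. S \<in> cospan_class R H H' T",
        OF mem_cospan_class_self[OF invertible_cospanD(1)[OF assms(3)]]]]
  by simp

lemma F_functor_cospan_class:
  fixes H H' :: "('a, 'm) herm_module"
  assumes "domain R" and H: "hermitian_module R bar H" and H': "hermitian_module R bar H'"
    and T: "invertible_cospan R H H' T"
  shows "on_arr (F_functor R) H H' (cospan_class R H H' T)
    = {(x, cospan_map H H' T x) | x. x \<in> carrier H}"
proof -
  note mods = hermitian_moduleD(1)[OF H] hermitian_moduleD(1)[OF H']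
  let ?S = "SOME S. S \<in> cospan_class R H H' T"
  have "?S \<in> cospan_class R H H' T"
    by (rule someI[of "\<lambda>S. S \<in> cospan_class R H H' T",
          OF mem_cospan_class_self[OF invertible_cospanD(1)[OF T]]])
  note S = cospan_map_class[OF mods T this]
  show ?thesis
    using torsion_closure_graph[OF assms(1) H H' lin_isoD(1)[OF cospan_map_iso[OF mods T]]]
    by (simp add: F_functor_def cospan_rel_closure_def cospan_rel_invertible[OF S(1)] S(2))
qed

theorem proposition2p7:
  fixes R :: "('a, 'r) ring_scheme" and bar :: "'a \<Rightarrow> 'a"
    and L :: "(('a, 'm) herm_module, ('a, 'm) cospan set) cat"
  assumes "domain R"
    and "bar \<in> ring_hom R R"
    and "\<And>a. a \<in> carrier R \<Longrightarrow> bar (bar a) = a"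
    and "L = L_cat R bar"
  shows "Obj (core L) = {H. hermitian_module R bar H} \<and>
    (\<forall>H \<in> Obj (core L). \<forall>H' \<in> Obj (core L).
       Hom (core L) H H' =
         {cospan_class R H H' T | T. lagrangian_cospan R bar H H' T \<and> invertible_cospan R H H' T}) \<and>
    (\<forall>H \<in> Obj (core L). \<forall>H' \<in> Obj (core L). \<forall>T.
       lagrangian_cospan R bar H H' T \<and> invertible_cospan R H H' T \<longrightarrow>
       on_arr core_functor H H' (cospan_class R H H' T) = cospan_map H H' T) \<and>
    is_equivalence (core L) (U_cat R bar) core_functor \<and>
    functors_equal (core L) (Lagr_cat R bar)
      (comp_functor (F_functor R) core_inclusion) (comp_functor graph_functor core_functor)"
proof (intro conjI ballI allI impI)
  let ?U = "U_cat R bar :: (('a, 'm) herm_module, 'm \<Rightarrow> 'm) cat"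
  let ?G = "\<lambda>H H' \<phi>. cospan_class R H H' (map_cospan H' \<phi>) :: ('a, 'm) cospan set"
  show Obj: "Obj (core L) = {H. hermitian_module R bar H}"
    by (simp add: assms(4) core_def L_cat_def)
  have Hom: "Hom (core L) H H' = ?G H H' ` Hom ?U H H'"
    if "hermitian_module R bar H" "hermitian_module R bar H'" for H H'
    using cat_iso_L_cat[OF assms(1) that] by (simp add: assms(4) core_def)
  show "Hom (core L) H H' =
      {cospan_class R H H' T | T. lagrangian_cospan R bar H H' T \<and> invertible_cospan R H H' T}"
    if "H \<in> Obj (core L)" "H' \<in> Obj (core L)" for H H'
  proof -
    have H: "hermitian_module R bar H" "hermitian_module R bar H'"
      using that by (simp_all add: Obj)
    show ?thesis
      using Hom[OF H] lagrangian_invertible_classes[OF assms(1) H] by simp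
  qed
  show "on_arr core_functor H H' (cospan_class R H H' T) = cospan_map H H' T"
    if "H \<in> Obj (core L)" "H' \<in> Obj (core L)"
      "lagrangian_cospan R bar H H' T \<and> invertible_cospan R H H' T" for H H' T
  proof -
    have H: "hermitian_module R bar H" "hermitian_module R bar H'"
      using that by (simp_all add: Obj)
    show ?thesis
      using core_functor_cospan_class[OF H[THEN hermitian_moduleD(1)]] that(3) by simp
  qed
  have core_G: "on_arr core_functor H H' (?G H H' \<phi>) = \<phi>"
    if H: "hermitian_module R bar H" and H': "hermitian_module R bar H'" and \<phi>: "\<phi> \<in> Hom ?U H H'" for H H' \<phi>
    using core_functor_cospan_class[OF hermitian_moduleD(1)[OF H] hermitian_moduleD(1)[OF H']
        lagrangian_map_cospan(2)[OF assms(1) H H' \<phi>]]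
      cospan_map_map_cospan[of \<phi> R H H'] \<phi> by (simp add: mem_U_Hom lin_isoD(1))
  have core_obj: "on_obj core_functor H = H" for H :: "('a, 'm) herm_module"
    by (simp add: core_functor_def)
  have U_Obj: "Obj ?U = {H. hermitian_module R bar H}"
    by (simp add: U_cat_def)
  show "is_equivalence (core L) ?U core_functor"
  proof (rule equivalence_by_transport[where G = ?G])
    show "category ?U" by (rule category_U)
    show "Obj (core L) = Obj ?U" using Obj U_Obj by simp
    show "Hom (core L) H H' = ?G H H' ` Hom ?U H H'" if "H \<in> Obj ?U" "H' \<in> Obj ?U" for H H'
      using Hom that U_Obj by simp
    show "Comp (core L) H H' H'' (?G H' H'' \<psi>) (?G H H' \<phi>) = ?G H H'' (Comp ?U H H' H'' \<psi> \<phi>)"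
      if "H \<in> Obj ?U" "H' \<in> Obj ?U" "H'' \<in> Obj ?U" "\<phi> \<in> Hom ?U H H'" "\<psi> \<in> Hom ?U H' H''"
      for H H' H'' \<phi> \<psi>
    proof -
      have "Comp (core L) = comp_cospan_class R"
        by (simp add: assms(4) core_def L_cat_def)
      moreover have "Comp ?U H H' H'' \<psi> \<phi> = compose (carrier H) \<psi> \<phi>"
        by (simp add: U_cat_def)
      ultimately show ?thesis
        using comp_map_cospan_unitary[OF _ _ _ that(4,5)] that(1-3) U_Obj by simp
    qed
    show "Ident (core L) H = ?G H H (Ident ?U H)" for H
      by (simp add: assms(4) core_def L_cat_def U_cat_def id_cospan_eq_map_cospan)
    show "on_obj core_functor H = H" for H :: "('a, 'm) herm_module"
      by (rule core_obj)
    show "on_arr core_functor H H' (?G H H' \<phi>) = \<phi>"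
      if "H \<in> Obj ?U" "H' \<in> Obj ?U" "\<phi> \<in> Hom ?U H H'" for H H' \<phi>
      using core_G that U_Obj by simp
  qed
  have F_G: "on_arr (F_functor R) H H' (?G H H' \<phi>) = {(x, \<phi> x) | x. x \<in> carrier H}"
    if H: "hermitian_module R bar H" and H': "hermitian_module R bar H'" and \<phi>: "\<phi> \<in> Hom ?U H H'" for H H' \<phi>
    using F_functor_cospan_class[OF assms(1) H H' lagrangian_map_cospan(2)[OF assms(1) H H' \<phi>]]
      cospan_map_map_cospan[of \<phi> R H H'] \<phi> by (simp add: mem_U_Hom lin_isoD(1))
  have lagr: "lagrangian R (herm_sum R (herm_neg R H) H') {(x, \<phi> x) | x. x \<in> carrier H}"
    if H: "hermitian_module R bar H" and H': "hermitian_module R bar H'" and \<phi>: "\<phi> \<in> Hom ?U H H'" for H H' \<phi>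
    using lagrangian_graph_iff_unitary[OF H H'] \<phi> by (simp add: mem_U_Hom)
  show "functors_equal (core L) (Lagr_cat R bar)
      (comp_functor (F_functor R) core_inclusion) (comp_functor graph_functor core_functor)"
    unfolding functors_equal_def
  proof (intro conjI ballI)
    fix H H' c assume HH': "H \<in> Obj (core L)" "H' \<in> Obj (core L)" and "c \<in> Hom (core L) H H'"
    then obtain \<phi> where \<phi>: "\<phi> \<in> Hom ?U H H'" "c = ?G H H' \<phi>"
      using Hom by (auto simp: Obj)
    have H: "hermitian_module R bar H" "hermitian_module R bar H'"
      using HH' by (simp_all add: Obj)
    have F: "on_arr (comp_functor (F_functor R) core_inclusion) H H' c = {(x, \<phi> x) | x. x \<in> carrier H}"
      using F_G[OF H \<phi>(1)] \<phi>(2) by (simp add: comp_functor_def core_inclusion_def id_functor_def)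
    have "on_arr (comp_functor graph_functor core_functor) H H' c = {(x, \<phi> x) | x. x \<in> carrier H}"
      using core_G[OF H \<phi>(1)] \<phi>(2) core_obj by (simp add: comp_functor_def graph_functor_def)
    with F show "on_arr (comp_functor (F_functor R) core_inclusion) H H' c
        = on_arr (comp_functor graph_functor core_functor) H H' c"
      by simp
    show "on_arr (comp_functor (F_functor R) core_inclusion) H H' c
        \<in> Hom (Lagr_cat R bar) (on_obj (comp_functor (F_functor R) core_inclusion) H)
            (on_obj (comp_functor (F_functor R) core_inclusion) H')"
      unfolding F using lagr[OF H \<phi>(1)]
      by (simp add: Lagr_cat_def comp_functor_def core_inclusion_def id_functor_def F_functor_def)
  qed (simp_all add: Obj Lagr_cat_def comp_functor_def core_inclusion_def id_functor_def F_functor_def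
      graph_functor_def core_functor_def)
qed

end
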